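(* Let $R$ be a $\Phi$-structured poset. Suppose $\mathscr N$ is any set of elements of $R$ such that $wt(\mathbf n)\in\Lambda^+$ for each $\mathbf n\in\mathscr N$. Then the following are equivalent: (a) $\Pi(R)=\bigcup_{\mathbf n\in\mathscr N}\Pi(wt(\mathbf n))$ as an equality of edge-colored directed graphs; (b) $\Pi(R)=\bigcup_{\mathbf n\in\mathscr N}\Pi(wt(\mathbf n))$ as an equality of sets; (c) $\mathscr D\subseteq\mathscr N$ for some minimally indomitable set $\mathscr D$ of prominent elements in $R$.
   Context: $\Phi$ is a finite (reduced, crystallographic) root system in a Euclidean space with chosen simple roots $\{\alpha_i\}_{i\in I}$, coroots $\alpha^\vee=2\alpha/\langle\alpha,\alpha\rangle$, fundamental weights $\omega_i$ (dual to simple coroots), weight lattice $\Lambda=\bigoplus\mathbb Z\omega_i$, dominant weights $\Lambda^+=\bigoplus\mathbb Z_{\ge0}\omega_i$, Weyl group $W$. Partially order $\Lambda$ by $\mu\le\nu$ iff $\nu-\mu$ is a nonnegative integer combination of simple roots. For $\lambda\in\Lambda^+$, $\Pi(\lambda)=\{w(\nu): w\in W,\ \nu\in\Lambda^+,\ \nu\le\lambda\}$, regarded as an edge-colored directed graph with an edge $\mu\xrightarrow{i}\nu$ iff $\mu+\alpha_i=\nu$. All posets are finite and nonempty and identified with their Hasse diagrams (edge $\mathbf s\to\mathbf t$ iff $\mathbf t$ covers $\mathbf s$). A poset is ranked if there is a surjection $\rho:R\to\{0,\dots,l\}$ with $\rho(\mathbf s)+1=\rho(\mathbf t)$ whenever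 $\mathbf s\to\mathbf t$; $l$ is its length. For a ranked poset $R$ with Hasse edges colored by $I$, $\mathrm{comp}_i(\mathbf x)$ is the connected component of $\mathbf x$ using only color $i$ edges, $\rho_i(\mathbf x)$ is the rank of $\mathbf x$ in it, $l_i(\mathbf x)$ its length, $\delta_i=l_i-\rho_i$, $m_i=\rho_i-\delta_i$, and $wt(\mathbf x)=\sum_{i\in I}m_i(\mathbf x)\omega_i$. $R$ is $\Phi$-structured if $wt(\mathbf s)+\alpha_i=wt(\mathbf t)$ whenever $\mathbf s\xrightarrow{i}\mathbf t$ in $R$. For $\Phi$-structured $R$, $\Pi(R)$ is the edge-colored directed graph with vertex set $\{wt(\mathbf s):\mathbf s\in R\}$ and an edge $\mu\xrightarrow{i}\nu$ whenever there is an edge $\mathbf x\xrightarrow{i}\mathbf y$ in $R$ with $wt(\mathbf x)=\mu$, $wt(\mathbf y)=\nu$. A union of edge-colored directed graphs has the union of the vertex sets and, for each color, the union of the edge sets. An element $\mathbf x\in R$ is prominent if $\delta_i(\mathbf x)=0$ for all $i\in I$. A nonempty set $\mathscr D$ of prominent elements is indomitable if for every prominent $\mathbf x\in R$ there is $\mathbf d\in\mathscr D$ with $wt(\mathbf x)\le wt(\mathbf d)$; it is minimally indomitable if it is indomitable and no proper subset of it is indomitable. *)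

theory Defs
  imports "HOL-Analysis.Analysis"
begin

definition coroot :: "'a::euclidean_space \<Rightarrow> 'a"
  where "coroot \<alpha> = (2 / (\<alpha> \<bullet> \<alpha>)) *\<^sub>R \<alpha>"

definition root_reflection :: "'a::euclidean_space \<Rightarrow> 'a \<Rightarrow> 'a"
  where "root_reflection \<alpha> v = v - (v \<bullet> coroot \<alpha>) *\<^sub>R \<alpha>"

(* The roots are not required to span the ambient space, so the empty root system is included
   although the types of class euclidean_space have positive dimension. *)
definition root_system :: "'a::euclidean_space set \<Rightarrow> bool"
  where "root_system \<Phi> \<longleftrightarrow>
    finite \<Phi> \<and> 0 \<notin> \<Phi> \<and>
    (\<forall>\<alpha>\<in>\<Phi>. \<forall>\<beta>\<in>\<Phi>. root_reflection \<alpha> \<beta> \<in> \<Phi>) \<and>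
    (\<forall>\<alpha>\<in>\<Phi>. \<forall>\<beta>\<in>\<Phi>. \<beta> \<bullet> coroot \<alpha> \<in> \<int>) \<and>
    (\<forall>\<alpha>\<in>\<Phi>. \<forall>c. c *\<^sub>R \<alpha> \<in> \<Phi> \<longrightarrow> c = 1 \<or> c = - 1)"

definition simple_roots :: "'a::euclidean_space set \<Rightarrow> 'i set \<Rightarrow> ('i \<Rightarrow> 'a) \<Rightarrow> bool"
  where "simple_roots \<Phi> I \<alpha> \<longleftrightarrow>
    inj_on \<alpha> I \<and> \<alpha> ` I \<subseteq> \<Phi> \<and> independent (\<alpha> ` I) \<and>
    (\<forall>\<beta>\<in>\<Phi>. \<exists>k :: 'i \<Rightarrow> nat.
        \<beta> = (\<Sum>i\<in>I. real (k i) *\<^sub>R \<alpha> i) \<or> \<beta> = - (\<Sum>i\<in>I. real (k i) *\<^sub>R \<alpha> i))"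

(* Reflections are involutions, so the monoid they generate under composition is a group. *)
inductive_set weyl_group :: "'a::euclidean_space set \<Rightarrow> ('a \<Rightarrow> 'a) set" for \<Phi>
  where
    id: "id \<in> weyl_group \<Phi>"
  | refl: "\<alpha> \<in> \<Phi> \<Longrightarrow> root_reflection \<alpha> \<in> weyl_group \<Phi>"
  | comp: "v \<in> weyl_group \<Phi> \<Longrightarrow> w \<in> weyl_group \<Phi> \<Longrightarrow> v \<circ> w \<in> weyl_group \<Phi>"

(* Basis of the span of the roots dual to the simple coroots; the span condition gives uniqueness
   when the roots do not span the ambient space. *)
definition fundamental_weight :: "'i set \<Rightarrow> ('i \<Rightarrow> 'a::euclidean_space) \<Rightarrow> 'i \<Rightarrow> 'a"
  where "fundamental_weight I \<alpha> i =
    (THE \<omega>. \<omega> \<in> span (\<alpha> ` I) \<and>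
            (\<forall>j\<in>I. \<omega> \<bullet> coroot (\<alpha> j) = (if j = i then 1 else 0)))"

definition dominant_weights :: "'i set \<Rightarrow> ('i \<Rightarrow> 'a::euclidean_space) \<Rightarrow> 'a set"
  where "dominant_weights I \<alpha> =
    {\<Sum>i\<in>I. real (c i) *\<^sub>R fundamental_weight I \<alpha> i | c :: 'i \<Rightarrow> nat. True}"

definition weight_le :: "'i set \<Rightarrow> ('i \<Rightarrow> 'a::euclidean_space) \<Rightarrow> 'a \<Rightarrow> 'a \<Rightarrow> bool"
  where "weight_le I \<alpha> \<mu> \<nu> \<longleftrightarrow> (\<exists>k :: 'i \<Rightarrow> nat. \<nu> - \<mu> = (\<Sum>i\<in>I. real (k i) *\<^sub>R \<alpha> i))"

(* A triple (s, i, t) is an edge of color i from s to t. *)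
record ('v, 'c) colored_digraph =
  verts :: "'v set"
  edges :: "('v \<times> 'c \<times> 'v) set"

definition digraph_Union :: "('v, 'c) colored_digraph set \<Rightarrow> ('v, 'c) colored_digraph"
  where "digraph_Union \<G> = \<lparr>verts = (\<Union>G\<in>\<G>. verts G), edges = (\<Union>G\<in>\<G>. edges G)\<rparr>"

definition dominant_Pi ::
    "'a::euclidean_space set \<Rightarrow> 'i set \<Rightarrow> ('i \<Rightarrow> 'a) \<Rightarrow> 'a \<Rightarrow> ('a, 'i) colored_digraph"
  where "dominant_Pi \<Phi> I \<alpha> l =
    (let V = {w \<nu> | w \<nu>. w \<in> weyl_group \<Phi> \<and> \<nu> \<in> dominant_weights I \<alpha> \<and> weight_le I \<alpha> \<nu> l}
     in \<lparr>verts = V, edges = {(\<mu>, i, \<nu>). \<mu> \<in> V \<and> \<nu> \<in> V \<and> i \<in> I \<and> \<mu> + \<alpha> i = \<nu>}\<rparr>)"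

definition covers :: "'r set \<Rightarrow> 'r rel \<Rightarrow> 'r \<Rightarrow> 'r \<Rightarrow> bool"
  where "covers R le s t \<longleftrightarrow>
    s \<in> R \<and> t \<in> R \<and> (s, t) \<in> le \<and> s \<noteq> t \<and>
    \<not> (\<exists>u\<in>R. (s, u) \<in> le \<and> (u, t) \<in> le \<and> u \<noteq> s \<and> u \<noteq> t)"

definition hasse :: "'r set \<Rightarrow> 'r rel \<Rightarrow> ('r \<Rightarrow> 'r \<Rightarrow> 'i) \<Rightarrow> ('r, 'i) colored_digraph"
  where "hasse R le col = \<lparr>verts = R, edges = {(s, i, t). covers R le s t \<and> i = col s t}\<rparr>"

definition is_rank_function :: "'v set \<Rightarrow> 'v rel \<Rightarrow> ('v \<Rightarrow> nat) \<Rightarrow> nat \<Rightarrow> bool"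
  where "is_rank_function V E \<rho> l \<longleftrightarrow> \<rho> ` V = {0..l} \<and> (\<forall>(s, t)\<in>E. \<rho> s + 1 = \<rho> t)"

(* The rank of an element and the length are unique if the Hasse diagram (V, E) is connected;
   they are only used for monochromatic components. *)
definition rank_in :: "'v set \<Rightarrow> 'v rel \<Rightarrow> 'v \<Rightarrow> nat"
  where "rank_in V E x = (THE k. \<exists>\<rho> l. is_rank_function V E \<rho> l \<and> \<rho> x = k)"

definition length_of :: "'v set \<Rightarrow> 'v rel \<Rightarrow> nat"
  where "length_of V E = (THE l. \<exists>\<rho>. is_rank_function V E \<rho> l)"

definition color_edges :: "('v, 'i) colored_digraph \<Rightarrow> 'i \<Rightarrow> 'v rel"
  where "color_edges G i = {(s, t). (s, i, t) \<in> edges G}"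

definition color_comp :: "('v, 'i) colored_digraph \<Rightarrow> 'i \<Rightarrow> 'v \<Rightarrow> 'v set"
  where "color_comp G i x = {y. (x, y) \<in> (color_edges G i \<union> (color_edges G i)\<inverse>)\<^sup>*}"

definition comp_edges :: "('v, 'i) colored_digraph \<Rightarrow> 'i \<Rightarrow> 'v \<Rightarrow> 'v rel"
  where "comp_edges G i x = color_edges G i \<inter> (color_comp G i x \<times> color_comp G i x)"

(* color_rank, color_length and color_depth are rho_i, l_i and delta_i = l_i - rho_i; they are
   integers to avoid truncated subtraction in m_i = rho_i - delta_i. *)
definition color_rank :: "('v, 'i) colored_digraph \<Rightarrow> 'i \<Rightarrow> 'v \<Rightarrow> int"
  where "color_rank G i x = int (rank_in (color_comp G i x) (comp_edges G i x) x)"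

definition color_length :: "('v, 'i) colored_digraph \<Rightarrow> 'i \<Rightarrow> 'v \<Rightarrow> int"
  where "color_length G i x = int (length_of (color_comp G i x) (comp_edges G i x))"

definition color_depth :: "('v, 'i) colored_digraph \<Rightarrow> 'i \<Rightarrow> 'v \<Rightarrow> int"
  where "color_depth G i x = color_length G i x - color_rank G i x"

definition wt ::
    "'i set \<Rightarrow> ('i \<Rightarrow> 'a::euclidean_space) \<Rightarrow> ('v, 'i) colored_digraph \<Rightarrow> 'v \<Rightarrow> 'a"
  where "wt I \<alpha> G x =
    (\<Sum>i\<in>I. real_of_int (color_rank G i x - color_depth G i x) *\<^sub>R fundamental_weight I \<alpha> i)"

definition colored_ranked_poset :: "'i set \<Rightarrow> 'r set \<Rightarrow> 'r rel \<Rightarrow> ('r \<Rightarrow> 'r \<Rightarrow> 'i) \<Rightarrow> bool"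
  where "colored_ranked_poset I R le col \<longleftrightarrow>
    finite R \<and> R \<noteq> {} \<and> partial_order_on R le \<and>
    (\<exists>\<rho> l. is_rank_function R {(s, t). covers R le s t} \<rho> l) \<and>
    (\<forall>s t. covers R le s t \<longrightarrow> col s t \<in> I)"

definition structured_poset ::
    "'i set \<Rightarrow> ('i \<Rightarrow> 'a::euclidean_space) \<Rightarrow> 'r set \<Rightarrow> 'r rel \<Rightarrow> ('r \<Rightarrow> 'r \<Rightarrow> 'i) \<Rightarrow> bool"
  where "structured_poset I \<alpha> R le col \<longleftrightarrow>
    colored_ranked_poset I R le col \<and>
    (\<forall>(s, i, t) \<in> edges (hasse R le col).
        wt I \<alpha> (hasse R le col) s + \<alpha> i = wt I \<alpha> (hasse R le col) t)"

definition poset_Pi ::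
    "'i set \<Rightarrow> ('i \<Rightarrow> 'a::euclidean_space) \<Rightarrow> ('v, 'i) colored_digraph \<Rightarrow> ('a, 'i) colored_digraph"
  where "poset_Pi I \<alpha> G =
    \<lparr>verts = wt I \<alpha> G ` verts G,
     edges = {(wt I \<alpha> G x, i, wt I \<alpha> G y) | x i y. (x, i, y) \<in> edges G}\<rparr>"

definition prominent :: "'i set \<Rightarrow> ('v, 'i) colored_digraph \<Rightarrow> 'v \<Rightarrow> bool"
  where "prominent I G x \<longleftrightarrow> x \<in> verts G \<and> (\<forall>i\<in>I. color_depth G i x = 0)"

definition indomitable ::
    "'i set \<Rightarrow> ('i \<Rightarrow> 'a::euclidean_space) \<Rightarrow> ('v, 'i) colored_digraph \<Rightarrow> 'v set \<Rightarrow> bool"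
  where "indomitable I \<alpha> G D \<longleftrightarrow>
    D \<noteq> {} \<and> (\<forall>d\<in>D. prominent I G d) \<and>
    (\<forall>x. prominent I G x \<longrightarrow> (\<exists>d\<in>D. weight_le I \<alpha> (wt I \<alpha> G x) (wt I \<alpha> G d)))"

definition minimally_indomitable ::
    "'i set \<Rightarrow> ('i \<Rightarrow> 'a::euclidean_space) \<Rightarrow> ('v, 'i) colored_digraph \<Rightarrow> 'v set \<Rightarrow> bool"
  where "minimally_indomitable I \<alpha> G D \<longleftrightarrow>
    indomitable I \<alpha> G D \<and> (\<forall>D'. D' \<subset> D \<longrightarrow> \<not> indomitable I \<alpha> G D')"

end

theory Submission imports Defs begin

text \<open>
  The pairing of the weight of \<open>x\<close> with the \<open>i\<close>-th simple coroot is \<open>2 \<rho>\<^sub>i - l\<^sub>i\<close>, so the simple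
  reflection reverses the weights along the \<open>i\<close>-component of \<open>x\<close>, and the set of weights of \<open>R\<close> is
  stable under \<open>W\<close>. If this pairing is positive (negative), then \<open>x\<close> is not at the bottom (top) of
  its \<open>i\<close>-component, so \<open>R\<close> has an edge of color \<open>i\<close> ending (starting) at an element with the weight
  of \<open>x\<close>. Walking down such edges reaches every dominant weight below a weight of \<open>R\<close>, and since
  \<open>\<Pi>(\<nu>)\<close> is closed under the same steps, equality of the vertex sets implies equality of the
  edges. An element that is not prominent has smaller weight than an element of maximal rank in one
  of its components; hence elements of maximal weight are prominent, and every dominant weight of
  \<open>R\<close> lies below a maximal one. Conversely, an equality of vertex sets forces \<open>N\<close> to contain an
  element of each maximal weight, because \<open>w \<nu> \<le> \<nu>\<close> for dominant \<open>\<nu>\<close>.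
\<close>

section \<open>Monochromatic components\<close>

lemma rtrancl_crossing:
  assumes "(x, y) \<in> r\<^sup>*" "P x" "\<not> P y"
  shows "\<exists>u v. (x, u) \<in> r\<^sup>* \<and> (u, v) \<in> r \<and> P u \<and> \<not> P v"
  using assms by (induction rule: rtrancl_induct) (simp, blast)

lemma color_comp_refl: "x \<in> color_comp G i x"
  by (simp add: color_comp_def)

lemma color_comp_eq:
  assumes "y \<in> color_comp G i x"
  shows "color_comp G i y = color_comp G i x"
proof -
  let ?r = "color_edges G i \<union> (color_edges G i)\<inverse>"
  have "sym (?r\<^sup>*)" by (intro sym_rtrancl sym_Un_converse)
  moreover have "(x, y) \<in> ?r\<^sup>*" using assms by (simp add: color_comp_def)
  ultimately have "(y, x) \<in> ?r\<^sup>*" "(x, y) \<in> ?r\<^sup>*" by (auto dest: symD)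
  then show ?thesis unfolding color_comp_def by (auto intro: rtrancl_trans)
qed

lemma color_comp_edge:
  assumes "(s, i, t) \<in> edges G"
  shows "s \<in> color_comp G i x \<longleftrightarrow> t \<in> color_comp G i x"
proof -
  have "t \<in> color_comp G i s"
    using assms unfolding color_comp_def color_edges_def by auto
  then have "color_comp G i t = color_comp G i s" by (rule color_comp_eq)
  then show ?thesis by (metis color_comp_eq color_comp_refl)
qed

lemma color_comp_induct [consumes 1, case_names base up down]:
  assumes "y \<in> color_comp G i x" "P x"
    and "\<And>s t. s \<in> color_comp G i x \<Longrightarrow> t \<in> color_comp G i x \<Longrightarrow> (s, i, t) \<in> edges G \<Longrightarrow> P s \<Longrightarrow> P t"
    and "\<And>s t. s \<in> color_comp G i x \<Longrightarrow> t \<in> color_comp G i x \<Longrightarrow> (s, i, t) \<in> edges G \<Longrightarrow> P t \<Longrightarrow> P s"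
  shows "P y"
proof -
  have "(x, y) \<in> (color_edges G i \<union> (color_edges G i)\<inverse>)\<^sup>*"
    using assms(1) by (simp add: color_comp_def)
  then have "y \<in> color_comp G i x \<and> P y"
  proof (induction rule: rtrancl_induct)
    case base
    then show ?case using assms(2) by (simp add: color_comp_refl)
  next
    case (step y z)
    then show ?case
      using assms(3,4) color_comp_edge[of _ i _ G x] by (auto simp: color_edges_def)
  qed
  then show ?thesis by simp
qed

text \<open>A discrete intermediate value argument: an undirected path from \<open>a\<close> to
  \<open>b\<close> has a step from below \<open>k\<close> to \<open>k\<close> or above. As
  \<open>\<rho>\<close> changes by one, this step follows an edge upwards.\<close>

lemma color_comp_crossing:
  fixes \<rho> :: "'v \<Rightarrow> nat"
  assumes \<rho>: "\<And>s t. (s, i, t) \<in> edges G \<Longrightarrow> s \<in> color_comp G i x \<Longrightarrow> \<rho> s + 1 = \<rho> t"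
    and "a \<in> color_comp G i x" "b \<in> color_comp G i x" "\<rho> a < k" "k \<le> \<rho> b"
  shows "\<exists>s t. (s, i, t) \<in> edges G \<and> s \<in> color_comp G i x \<and> t \<in> color_comp G i x
           \<and> \<rho> s + 1 = k \<and> \<rho> t = k"
proof -
  let ?r = "color_edges G i \<union> (color_edges G i)\<inverse>"
  have C: "color_comp G i a = color_comp G i x" by (rule color_comp_eq) fact
  then have "(a, b) \<in> ?r\<^sup>*" using assms(3) by (auto simp: color_comp_def)
  from rtrancl_crossing[OF this, of "\<lambda>u. \<rho> u < k"] obtain u v
    where uv: "(a, u) \<in> ?r\<^sup>*" "(u, v) \<in> ?r" "\<rho> u < k" "k \<le> \<rho> v"
    using assms(4,5) by (auto simp: not_less)
  have "(a, v) \<in> ?r\<^sup>*" using uv by (metis rtrancl.rtrancl_into_rtrancl)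
  then have "u \<in> color_comp G i x" "v \<in> color_comp G i x"
    using uv(1) C by (auto simp: color_comp_def)
  moreover have "(u, i, v) \<in> edges G \<or> (v, i, u) \<in> edges G"
    using uv(2) by (auto simp: color_edges_def)
  ultimately show ?thesis using uv(3,4) \<rho>[of u v] \<rho>[of v u]
    by (metis Suc_eq_plus1 le_less_Suc_eq less_or_eq_imp_le not_less_eq_eq Suc_leI le_antisym)
qed

text \<open>Membership is demanded only of the lower endpoint, since an edge of color
  \<open>i\<close> has both endpoints in the component or neither.\<close>

lemma is_rank_function_comp:
  "is_rank_function (color_comp G i x) (comp_edges G i x) r l \<longleftrightarrow>
     r ` color_comp G i x = {0..l} \<and>
     (\<forall>s t. (s, i, t) \<in> edges G \<longrightarrow> s \<in> color_comp G i x \<longrightarrow> r s + 1 = r t)"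
  unfolding is_rank_function_def comp_edges_def color_edges_def
  using color_comp_edge[of _ i _ G x] by fastforce

text \<open>By connectedness, two rank functions of a component differ by a constant, and since both
  attain 0 the constant is 0. This makes the descriptions in \<open>rank_in\<close> and
  \<open>length_of\<close> meaningful.\<close>

lemma comp_rank_function_unique:
  assumes "is_rank_function (color_comp G i x) (comp_edges G i x) r l"
    and "is_rank_function (color_comp G i x) (comp_edges G i x) r' l'"
  shows "l = l'" and "y \<in> color_comp G i x \<Longrightarrow> r y = r' y"
proof -
  note r = assms[unfolded is_rank_function_comp]
  have diff: "int (r y) - int (r' y) = int (r x) - int (r' x)" if "y \<in> color_comp G i x" for y
    using that
  proof (induction rule: color_comp_induct)
    case (up s t)
    then have "r s + 1 = r t" "r' s + 1 = r' t" using r by auto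
    then show ?case using up by linarith
  next
    case (down s t)
    then have "r s + 1 = r t" "r' s + 1 = r' t" using r by auto
    then show ?case using down by linarith
  qed simp
  have "0 \<in> r ` color_comp G i x" "0 \<in> r' ` color_comp G i x" using r by auto
  then obtain a b where "a \<in> color_comp G i x" "r a = 0" "b \<in> color_comp G i x" "r' b = 0"
    by force
  then have eq: "r x = r' x" using diff[of a] diff[of b] by linarith
  then show *: "y \<in> color_comp G i x \<Longrightarrow> r y = r' y" for y using diff[of y] by linarith
  have "{0..l} = {0..l'}" using r * by (metis (no_types, lifting) image_cong)
  then show "l = l'" by (simp add: atLeastAtMost_def atMost_eq_iff)
qed

text \<open>Subtracting the minimum of \<open>\<rho>\<close> over the component makes the ranks
  start at 0; the crossing argument excludes gaps.\<close>

lemma comp_rank_function_exists: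
  fixes \<rho> :: "'v \<Rightarrow> nat"
  assumes \<rho>: "\<And>s t. (s, i, t) \<in> edges G \<Longrightarrow> \<rho> s + 1 = \<rho> t"
    and fin: "finite (color_comp G i x)"
  shows "\<exists>r l. is_rank_function (color_comp G i x) (comp_edges G i x) r l"
proof -
  let ?C = "color_comp G i x"
  define m where "m = Min (\<rho> ` ?C)"
  define M where "M = Max (\<rho> ` ?C)"
  have ne: "\<rho> ` ?C \<noteq> {}" using color_comp_refl by fast
  have "m \<in> \<rho> ` ?C" "M \<in> \<rho> ` ?C" unfolding m_def M_def using fin ne by auto
  then obtain a b where ab: "a \<in> ?C" "\<rho> a = m" "b \<in> ?C" "\<rho> b = M" by auto
  have le: "m \<le> \<rho> y" "\<rho> y \<le> M" if "y \<in> ?C" for y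
    using that fin unfolding m_def M_def by auto
  have all: "\<exists>y\<in>?C. \<rho> y = k" if "m \<le> k" "k \<le> M" for k
  proof (cases "k = m")
    case False
    then have "\<rho> a < k" "k \<le> \<rho> b" using ab that by auto
    then have "\<exists>s t. (s, i, t) \<in> edges G \<and> s \<in> ?C \<and> t \<in> ?C \<and> \<rho> s + 1 = k \<and> \<rho> t = k"
      by (intro color_comp_crossing[of i G x \<rho> a b k] \<rho> ab(1,3)) assumption+
    then show ?thesis by blast
  qed (use ab in auto)
  have "(\<lambda>y. \<rho> y - m) ` ?C = {0..M - m}"
  proof (intro equalityI subsetI)
    show "k \<in> {0..M - m}" if "k \<in> (\<lambda>y. \<rho> y - m) ` ?C" for k
      using that le by (auto intro: diff_le_mono)
  next
    fix k assume "k \<in> {0..M - m}"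
    then have "m \<le> k + m" "k + m \<le> M" using le[of a] ab by auto
    then obtain y where "y \<in> ?C" "\<rho> y = k + m" using all by blast
    then show "k \<in> (\<lambda>y. \<rho> y - m) ` ?C" by (intro image_eqI[of _ _ y]) auto
  qed
  moreover have "\<rho> s - m + 1 = \<rho> t - m" if "(s, i, t) \<in> edges G" "s \<in> ?C" for s t
    using \<rho>[OF that(1)] le(1)[OF that(2)] by linarith
  ultimately show ?thesis unfolding is_rank_function_comp by blast
qed

text \<open>One rank function of a component computes rank and length for all its elements, so the
  definite descriptions can be avoided from here on.\<close>

lemma color_rank_eq:
  assumes "is_rank_function (color_comp G i x) (comp_edges G i x) r l" "y \<in> color_comp G i x"
  shows "color_rank G i y = int (r y)" and "color_length G i y = int l"
proof -
  have C: "color_comp G i y = color_comp G i x" by (rule color_comp_eq) fact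
  then have E: "comp_edges G i y = comp_edges G i x" by (simp add: comp_edges_def)
  have "rank_in (color_comp G i x) (comp_edges G i x) y = r y"
    unfolding rank_in_def using assms(1) comp_rank_function_unique(2)[OF assms(1) _ assms(2)]
    by (intro the_equality) metis+
  then show "color_rank G i y = int (r y)" by (simp add: color_rank_def C E)
  have "length_of (color_comp G i x) (comp_edges G i x) = l"
    unfolding length_of_def using assms(1) comp_rank_function_unique(1)[OF assms(1)]
    by (intro the_equality) metis+
  then show "color_length G i y = int l" by (simp add: color_length_def C E)
qed

section \<open>Root systems and dominant weights\<close>

lemma root_reflection_linear: "linear (root_reflection \<alpha>)"
  unfolding root_reflection_def by (intro linearI) (simp_all add: algebra_simps)

lemmas root_reflection_simps =
  linear_add[OF root_reflection_linear] linear_diff[OF root_reflection_linear]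
  linear_neg[OF root_reflection_linear] linear_scale[OF root_reflection_linear]

lemma inner_coroot: "v \<bullet> coroot \<alpha> = 2 * (v \<bullet> \<alpha>) / (\<alpha> \<bullet> \<alpha>)"
  by (simp add: coroot_def)

lemma root_reflection_involution:
  assumes "\<alpha> \<noteq> 0"
  shows "root_reflection \<alpha> (root_reflection \<alpha> v) = v"
  using assms unfolding root_reflection_def
  by (simp add: inner_coroot algebra_simps)

lemma root_reflection_adjoint:
  "root_reflection \<alpha> v \<bullet> u = v \<bullet> root_reflection \<alpha> u"
  unfolding root_reflection_def by (simp add: inner_coroot algebra_simps inner_commute)

lemma root_reflection_isometry:
  assumes "\<alpha> \<noteq> 0"
  shows "root_reflection \<alpha> v \<bullet> root_reflection \<alpha> u = v \<bullet> u"
  by (simp add: root_reflection_adjoint root_reflection_involution assms)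

lemma root_reflection_conjugate:
  assumes "linear f" "\<And>u v. f u \<bullet> f v = u \<bullet> v"
  shows "root_reflection (f \<beta>) (f v) = f (root_reflection \<beta> v)"
  unfolding root_reflection_def
  by (simp add: inner_coroot assms linear_diff[OF assms(1)] linear_scale[OF assms(1)])

lemma root_reflection_minus: "root_reflection (- \<alpha>) = root_reflection \<alpha>"
  by (rule ext) (simp add: root_reflection_def inner_coroot)

section \<open>Simple roots, fundamental weights and the weight lattice\<close>

locale root_basis =
  fixes \<Phi> :: "'a::euclidean_space set" and I :: "'i set" and \<alpha> :: "'i \<Rightarrow> 'a"
  assumes root_system: "root_system \<Phi>" and simple: "simple_roots \<Phi> I \<alpha>"
begin

abbreviation "\<omega> \<equiv> fundamental_weight I \<alpha>"
abbreviation "s i \<equiv> root_reflection (\<alpha> i)"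
abbreviation "wle \<equiv> weight_le I \<alpha>"

lemma inj: "inj_on \<alpha> I" and indep: "independent (\<alpha> ` I)"
  using simple by (auto simp: simple_roots_def)

lemma finite_I: "finite I"
  using inj indep independent_imp_finite finite_imageD by blast

lemma simple_root: "i \<in> I \<Longrightarrow> \<alpha> i \<in> \<Phi>"
  using simple by (auto simp: simple_roots_def)

lemma root_nonzero: "\<beta> \<in> \<Phi> \<Longrightarrow> \<beta> \<noteq> 0"
  using root_system by (auto simp: root_system_def)

lemma simple_nonzero: "i \<in> I \<Longrightarrow> \<alpha> i \<noteq> 0"
  using simple_root root_nonzero by blast

lemma reflection_root: "\<beta> \<in> \<Phi> \<Longrightarrow> \<gamma> \<in> \<Phi> \<Longrightarrow> root_reflection \<beta> \<gamma> \<in> \<Phi>"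
  using root_system by (auto simp: root_system_def)

lemma root_integral: "\<beta> \<in> \<Phi> \<Longrightarrow> \<gamma> \<in> \<Phi> \<Longrightarrow> \<gamma> \<bullet> coroot \<beta> \<in> \<int>"
  using root_system by (auto simp: root_system_def)

lemma simple_coroot_self: "i \<in> I \<Longrightarrow> \<alpha> i \<bullet> coroot (\<alpha> i) = 2"
  by (simp add: inner_coroot simple_nonzero)

text \<open>Coroots are multiples of roots, so \<open>v\<close> is orthogonal to the span of the
  simple roots and hence to itself.\<close>

lemma orthogonal_span_zero:
  assumes "v \<in> span (\<alpha> ` I)" "\<And>j. j \<in> I \<Longrightarrow> v \<bullet> coroot (\<alpha> j) = 0"
  shows "v = 0"
proof -
  have "orthogonal v u" if "u \<in> span (\<alpha> ` I)" for u
    using that assms(2) simple_nonzero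
    by (intro orthogonal_to_span[of u "\<alpha> ` I"]) (auto simp: orthogonal_def inner_coroot)
  then show ?thesis using assms(1) by (metis orthogonal_self)
qed

text \<open>The component of \<open>\<alpha> i\<close> orthogonal to the other simple roots is a multiple of \<open>\<omega> i\<close>.\<close>
lemma fundamental_weight_exists:
  assumes "i \<in> I"
  shows "\<exists>w. w \<in> span (\<alpha> ` I) \<and> (\<forall>j\<in>I. w \<bullet> coroot (\<alpha> j) = (if j = i then 1 else 0))"
proof -
  let ?U = "\<alpha> ` (I - {i})"
  obtain y z where yz: "y \<in> span ?U" "\<And>w. w \<in> span ?U \<Longrightarrow> orthogonal z w" "\<alpha> i = y + z"
    using orthogonal_subspace_decomp_exists[of ?U "\<alpha> i"] by metis
  have "?U = \<alpha> ` I - {\<alpha> i}" using inj assms by (auto simp: inj_on_def)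
  then have "\<alpha> i \<notin> span ?U" using indep assms by (metis dependent_def imageI)
  then have z: "z \<noteq> 0" using yz by auto
  have zi: "z \<bullet> \<alpha> i = z \<bullet> z" using yz by (simp add: inner_add_right orthogonal_def)
  have zj: "z \<bullet> \<alpha> j = 0" if "j \<in> I" "j \<noteq> i" for j
    using yz(2)[of "\<alpha> j"] that by (auto simp: orthogonal_def span_base)
  have "y \<in> span (\<alpha> ` I)" using yz(1) span_mono[of ?U "\<alpha> ` I"] by blast
  then have "z \<in> span (\<alpha> ` I)"
    using yz(3) assms by (metis add_diff_cancel_left' image_eqI span_base span_diff)
  \<comment> \<open>As \<open>z\<close> has the same inner product with \<open>\<alpha> i\<close> as
    with itself, this multiple of it pairs to 1 with the coroot of
    \<open>\<alpha> i\<close>.\<close>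
  then show ?thesis using z zi zj simple_nonzero assms
    by (intro exI[of _ "((\<alpha> i \<bullet> \<alpha> i) / (2 * (z \<bullet> z))) *\<^sub>R z"])
      (auto simp: span_scale inner_coroot)
qed

lemma fundamental_weight:
  assumes "i \<in> I"
  shows fundamental_weight_span: "\<omega> i \<in> span (\<alpha> ` I)"
    and fundamental_weight_dual: "\<And>j. j \<in> I \<Longrightarrow> \<omega> i \<bullet> coroot (\<alpha> j) = (if j = i then 1 else 0)"
proof -
  have "\<exists>!w. w \<in> span (\<alpha> ` I) \<and> (\<forall>j\<in>I. w \<bullet> coroot (\<alpha> j) = (if j = i then 1 else 0))"
  proof (rule ex_ex1I[OF fundamental_weight_exists[OF assms]])
    fix w w'
    assume "w \<in> span (\<alpha> ` I) \<and> (\<forall>j\<in>I. w \<bullet> coroot (\<alpha> j) = (if j = i then 1 else 0))"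
      "w' \<in> span (\<alpha> ` I) \<and> (\<forall>j\<in>I. w' \<bullet> coroot (\<alpha> j) = (if j = i then 1 else 0))"
    then have "w - w' = 0" by (intro orthogonal_span_zero) (auto simp: span_diff inner_diff_left)
    then show "w = w'" by simp
  qed
  from theI'[OF this, folded fundamental_weight_def]
  show "\<omega> i \<in> span (\<alpha> ` I)"
    "\<And>j. j \<in> I \<Longrightarrow> \<omega> i \<bullet> coroot (\<alpha> j) = (if j = i then 1 else 0)" by auto
qed

lemma inner_sum_fundamental:
  assumes "j \<in> I"
  shows "(\<Sum>i\<in>I. c i *\<^sub>R \<omega> i) \<bullet> coroot (\<alpha> j) = c j"
proof -
  have "(\<Sum>i\<in>I. c i *\<^sub>R \<omega> i) \<bullet> coroot (\<alpha> j) = (\<Sum>i\<in>I. if j = i then c i else 0)"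
    unfolding inner_sum_left
    by (rule sum.cong) (auto simp: fundamental_weight_dual assms)
  then show ?thesis using assms finite_I by simp
qed

lemma sum_fundamental_span: "(\<Sum>i\<in>I. c i *\<^sub>R \<omega> i) \<in> span (\<alpha> ` I)"
  by (intro span_sum span_scale fundamental_weight_span)

text \<open>The weight lattice, given by pairings with simple coroots rather than by coordinates; in
  this form stability under reflections is immediate from integrality.\<close>

definition weights :: "'a set"
  where "weights = {v \<in> span (\<alpha> ` I). \<forall>i\<in>I. v \<bullet> coroot (\<alpha> i) \<in> \<int>}"

text \<open>The coordinates of a weight in the fundamental weights are its pairings with the simple
  coroots.\<close>

lemma dominant_weights_iff:
  "v \<in> dominant_weights I \<alpha> \<longleftrightarrow> v \<in> weights \<and> (\<forall>i\<in>I. v \<bullet> coroot (\<alpha> i) \<ge> 0)"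
proof
  assume "v \<in> dominant_weights I \<alpha>"
  then show "v \<in> weights \<and> (\<forall>i\<in>I. v \<bullet> coroot (\<alpha> i) \<ge> 0)"
    unfolding dominant_weights_def weights_def
    by (auto simp: inner_sum_fundamental sum_fundamental_span)
next
  assume v: "v \<in> weights \<and> (\<forall>i\<in>I. v \<bullet> coroot (\<alpha> i) \<ge> 0)"
  then have "\<forall>i\<in>I. \<exists>n::nat. v \<bullet> coroot (\<alpha> i) = real n"
    unfolding weights_def by (metis (no_types, lifting) Ints_cases Nats_altdef2 Nats_cases
        mem_Collect_eq)
  then obtain c :: "'i \<Rightarrow> nat" where c: "\<And>i. i \<in> I \<Longrightarrow> v \<bullet> coroot (\<alpha> i) = real (c i)" by metis
  have "v - (\<Sum>i\<in>I. real (c i) *\<^sub>R \<omega> i) = 0"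
    using v by (intro orthogonal_span_zero span_diff sum_fundamental_span)
      (auto simp: weights_def inner_diff_left inner_sum_fundamental c)
  then show "v \<in> dominant_weights I \<alpha>" unfolding dominant_weights_def by auto
qed

lemma simple_root_weight: "i \<in> I \<Longrightarrow> \<alpha> i \<in> weights"
  by (simp add: weights_def span_base root_integral simple_root)

lemma weights_diff: "u \<in> weights \<Longrightarrow> v \<in> weights \<Longrightarrow> u - v \<in> weights"
  by (simp add: weights_def span_diff inner_diff_left)

lemma reflection_weight:
  assumes "i \<in> I" "v \<in> weights"
  shows "s i v \<in> weights"
  unfolding weights_def root_reflection_def
  using assms simple_root_weight[of i]
  by (auto simp: weights_def inner_diff_left intro!: span_diff span_scale Ints_diff Ints_mult)

text \<open>The summands are the fundamental coweights, dual to the simple roots. Pairing with their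
  sum is thus the height, which serves as termination measure and detects maximal weights.\<close>

definition coweight_sum :: 'a
  where "coweight_sum = (\<Sum>j\<in>I. (2 / (\<alpha> j \<bullet> \<alpha> j)) *\<^sub>R \<omega> j)"

lemma coweight_dual:
  assumes "i \<in> I" "j \<in> I"
  shows "\<alpha> i \<bullet> ((2 / (\<alpha> j \<bullet> \<alpha> j)) *\<^sub>R \<omega> j) = (if i = j then 1 else 0)"
  using fundamental_weight_dual[OF assms(2,1)] simple_nonzero[OF assms(1)] simple_nonzero[OF assms(2)]
  by (simp add: inner_coroot inner_commute[of "\<alpha> i" "\<omega> j"] field_simps split: if_splits)

lemma inner_coweight:
  assumes "j \<in> I"
  shows "(\<Sum>i\<in>I. c i *\<^sub>R \<alpha> i) \<bullet> ((2 / (\<alpha> j \<bullet> \<alpha> j)) *\<^sub>R \<omega> j) = c j"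
proof -
  have "(\<Sum>i\<in>I. c i *\<^sub>R \<alpha> i) \<bullet> ((2 / (\<alpha> j \<bullet> \<alpha> j)) *\<^sub>R \<omega> j) = (\<Sum>i\<in>I. c i * (if i = j then 1 else 0))"
    unfolding inner_sum_left
    by (rule sum.cong) (simp_all only: inner_scaleR_left coweight_dual assms)
  also have "\<dots> = (\<Sum>i\<in>I. if i = j then c i else 0)" by (rule sum.cong) auto
  finally show ?thesis using assms finite_I by simp
qed

lemma inner_coweight_sum: "(\<Sum>i\<in>I. c i *\<^sub>R \<alpha> i) \<bullet> coweight_sum = (\<Sum>i\<in>I. c i)"
  unfolding coweight_sum_def inner_sum_right by (rule sum.cong) (simp_all only: inner_coweight)

lemma simple_coweight_sum:
  assumes "i \<in> I"
  shows "\<alpha> i \<bullet> coweight_sum = 1"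
  unfolding coweight_sum_def inner_sum_right
  using assms finite_I by (simp only: coweight_dual sum.delta cong: sum.cong) simp

section \<open>The cone of nonnegative integer combinations of simple roots\<close>

abbreviation "nonneg v \<equiv> wle 0 v"

text \<open>Since \<open>nonneg\<close> is itself an instance of \<open>wle\<close>, unrestricted
  rewriting with this rule would loop; it is used with the first argument instantiated.\<close>

lemma wle_iff: "wle \<mu> \<nu> \<longleftrightarrow> nonneg (\<nu> - \<mu>)"
  by (simp add: weight_le_def)

lemma nonneg_iff: "nonneg v \<longleftrightarrow> (\<exists>k :: 'i \<Rightarrow> nat. v = (\<Sum>i\<in>I. real (k i) *\<^sub>R \<alpha> i))"
  by (simp add: weight_le_def)

lemma nonneg_zero: "nonneg 0"
  unfolding nonneg_iff by (intro exI[of _ "\<lambda>_. 0"]) simp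

lemma nonneg_add: "nonneg u \<Longrightarrow> nonneg v \<Longrightarrow> nonneg (u + v)"
  unfolding nonneg_iff
  by (elim exE, rule_tac x = "\<lambda>i. k i + ka i" in exI) (simp add: sum.distrib scaleR_add_left)

lemma nonneg_scale: "nonneg v \<Longrightarrow> nonneg (real n *\<^sub>R v)"
  by (induction n) (simp_all add: nonneg_zero nonneg_add scaleR_add_left)

lemma nonneg_scale_int: "nonneg v \<Longrightarrow> c \<in> \<int> \<Longrightarrow> c \<ge> 0 \<Longrightarrow> nonneg (c *\<^sub>R v)"
  using nonneg_scale by (metis Nats_altdef2 Nats_cases mem_Collect_eq)

lemma nonneg_simple:
  assumes "i \<in> I"
  shows "nonneg (\<alpha> i)"
proof -
  have "(\<Sum>j\<in>I. real (if j = i then 1 else 0) *\<^sub>R \<alpha> j) = (\<Sum>j\<in>I. if j = i then \<alpha> j else 0)"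
    by (rule sum.cong) auto
  also have "\<dots> = \<alpha> i" using assms finite_I by simp
  finally show ?thesis unfolding nonneg_iff by metis
qed

lemma nonneg_height: "nonneg v \<Longrightarrow> v \<bullet> coweight_sum \<ge> 0"
  unfolding nonneg_iff by (elim exE) (simp only: inner_coweight_sum, simp add: sum_nonneg)

lemma nonneg_height_zero:
  assumes "nonneg v" "v \<bullet> coweight_sum \<le> 0"
  shows "v = 0"
proof -
  obtain k :: "'i \<Rightarrow> nat" where v: "v = (\<Sum>i\<in>I. real (k i) *\<^sub>R \<alpha> i)"
    using assms(1) unfolding nonneg_iff by blast
  then have "(\<Sum>i\<in>I. real (k i)) \<le> 0" using assms(2) by (simp add: inner_coweight_sum)
  then have "(\<Sum>i\<in>I. real (k i)) = 0" by (meson antisym of_nat_0_le_iff sum_nonneg)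
  then have "\<forall>i\<in>I. k i = 0" using finite_I by (simp add: sum_nonneg_eq_0_iff)
  then show ?thesis by (simp add: v)
qed

lemma nonneg_antisym: "nonneg v \<Longrightarrow> nonneg (- v) \<Longrightarrow> v = 0"
  using nonneg_height[of "- v"] nonneg_height_zero[of v] by simp

lemma wle_refl: "wle \<mu> \<mu>"
  by (simp add: wle_iff[of \<mu>] nonneg_zero)

lemma wle_trans: "wle \<mu> \<nu> \<Longrightarrow> wle \<nu> \<kappa> \<Longrightarrow> wle \<mu> \<kappa>"
  using nonneg_add[of "\<nu> - \<mu>" "\<kappa> - \<nu>"] wle_iff[of \<mu>] wle_iff[of \<nu>] by simp

lemma wle_height: "wle \<mu> \<nu> \<Longrightarrow> \<mu> \<bullet> coweight_sum \<le> \<nu> \<bullet> coweight_sum"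
  using nonneg_height[of "\<nu> - \<mu>"] wle_iff[of \<mu>] by (simp add: inner_diff_left)

lemma wle_height_eq: "wle \<mu> \<nu> \<Longrightarrow> \<nu> \<bullet> coweight_sum \<le> \<mu> \<bullet> coweight_sum \<Longrightarrow> \<mu> = \<nu>"
  using nonneg_height_zero[of "\<nu> - \<mu>"] wle_iff[of \<mu>] by (simp add: inner_diff_left)

lemma root_signed: "\<beta> \<in> \<Phi> \<Longrightarrow> nonneg \<beta> \<or> nonneg (- \<beta>)"
  using simple unfolding simple_roots_def nonneg_iff by (metis minus_minus)

text \<open>A simple reflection changes only one simple coordinate of a root, and a positive root that
  is not simple has at least two positive coordinates.\<close>
lemma simple_reflection_positive:
  assumes "i \<in> I" "\<beta> \<in> \<Phi>" "nonneg \<beta>" "\<beta> \<noteq> \<alpha> i"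
  shows "nonneg (s i \<beta>)"
proof (rule ccontr)
  assume neg: "\<not> nonneg (s i \<beta>)"
  have "s i \<beta> \<in> \<Phi>" using assms simple_root reflection_root by blast
  then have "nonneg (- s i \<beta>)" using root_signed neg by blast
  then obtain k' :: "'i \<Rightarrow> nat" where k': "- s i \<beta> = (\<Sum>j\<in>I. real (k' j) *\<^sub>R \<alpha> j)"
    unfolding nonneg_iff by blast
  obtain k :: "'i \<Rightarrow> nat" where k: "\<beta> = (\<Sum>j\<in>I. real (k j) *\<^sub>R \<alpha> j)"
    using assms unfolding nonneg_iff by blast
  \<comment> \<open>The coefficient of \<open>\<alpha> j\<close> is the same in
    \<open>\<beta>\<close> and \<open>s i \<beta>\<close>, but is \<open>k j\<close> in the former
    and \<open>- k' j\<close> in the latter.\<close>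
  have "k j = 0" if "j \<in> I - {i}" for j
  proof -
    let ?c = "(2 / (\<alpha> j \<bullet> \<alpha> j)) *\<^sub>R \<omega> j"
    have j: "j \<in> I" using that by simp
    have "\<alpha> i \<bullet> ?c = 0" using coweight_dual[OF assms(1) j] that by auto
    moreover have "\<beta> - s i \<beta> = (\<beta> \<bullet> coroot (\<alpha> i)) *\<^sub>R \<alpha> i" by (simp add: root_reflection_def)
    ultimately have "(\<beta> - s i \<beta>) \<bullet> ?c = 0" by (metis inner_scaleR_left mult_zero_right)
    then have "\<beta> \<bullet> ?c + (- s i \<beta>) \<bullet> ?c = 0" by (metis diff_conv_add_uminus inner_add_left)
    moreover have "\<beta> \<bullet> ?c = real (k j)" unfolding k by (rule inner_coweight[OF j])
    moreover have "(- s i \<beta>) \<bullet> ?c = real (k' j)" unfolding k' by (rule inner_coweight[OF j])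
    ultimately show ?thesis by linarith
  qed
  \<comment> \<open>Now \<open>\<beta>\<close> is a nonnegative multiple of
    \<open>\<alpha> i\<close>, and in a reduced root system the factor can only be 1.\<close>
  then have "\<beta> = real (k i) *\<^sub>R \<alpha> i"
    unfolding k using assms(1) finite_I by (simp add: sum.remove)
  then have "real (k i) = 1 \<or> real (k i) = - 1"
    using assms(1,2) simple_root root_system unfolding root_system_def by metis
  then have "real (k i) = 1" by linarith
  then show False using \<open>\<beta> = real (k i) *\<^sub>R \<alpha> i\<close> assms(4) by simp
qed

section \<open>Words in simple reflections and dominant conjugates\<close>

primrec word :: "'i list \<Rightarrow> 'a \<Rightarrow> 'a"
  where "word [] v = v" | "word (i # is) v = s i (word is v)"

lemma word_append: "word (is @ js) v = word is (word js v)"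
  by (induction "is") auto

lemma word_linear: "linear (word is)"
proof (induction "is")
  case Nil
  show ?case by (rule linearI) simp_all
next
  case (Cons i "is")
  have "word (i # is) = s i \<circ> word is" by (rule ext) simp
  then show ?case by (simp only: linear_compose[OF Cons.IH root_reflection_linear])
qed

lemmas word_simps = linear_diff[OF word_linear] linear_add[OF word_linear]
  linear_scale[OF word_linear] linear_neg[OF word_linear]

lemma word_isometry: "is \<in> lists I \<Longrightarrow> word is u \<bullet> word is v = u \<bullet> v"
  by (induction "is") (auto simp: root_reflection_isometry simple_nonzero)

lemma word_root: "is \<in> lists I \<Longrightarrow> \<beta> \<in> \<Phi> \<Longrightarrow> word is \<beta> \<in> \<Phi>"
  by (induction "is") (auto intro: reflection_root simple_root)

lemma word_weight: "is \<in> lists I \<Longrightarrow> v \<in> weights \<Longrightarrow> word is v \<in> weights"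
  by (induction "is") (auto intro: reflection_weight)

lemma word_rev: "is \<in> lists I \<Longrightarrow> word (rev is) (word is v) = v"
  by (induction "is" arbitrary: v)
    (auto simp: word_append root_reflection_involution simple_nonzero)

lemma word_lists_rev: "is \<in> lists I \<Longrightarrow> rev is \<in> lists I"
  by (simp add: in_lists_conv_set)

lemma word_weyl: "is \<in> lists I \<Longrightarrow> word is \<in> weyl_group \<Phi>"
proof (induction "is")
  case Nil
  have "word [] = id" by (rule ext) simp
  then show ?case by (simp only: weyl_group.id)
next
  case (Cons i "is")
  have "word (i # is) = s i \<circ> word is" by (rule ext) simp
  moreover have "s i \<circ> word is \<in> weyl_group \<Phi>"
    using Cons by (intro weyl_group.comp weyl_group.refl simple_root) auto
  ultimately show ?case by (simp only:)
qed

text \<open>The letters of the word act from right to left; at the letter \<open>j\<close> that makes \<open>\<alpha> i\<close> negative,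
  the image of \<open>\<alpha> i\<close> is \<open>\<alpha> j\<close>, and this letter can be deleted together with the final \<open>i\<close>.\<close>
lemma word_deletion:
  assumes "is \<in> lists I" "i \<in> I" "nonneg (- word is (\<alpha> i))"
  shows "\<exists>js\<in>lists I. length js < length is \<and> (\<forall>v. word is (s i v) = word js v)"
  using assms(1,3)
proof (induction "is")
  case Nil
  then have "\<alpha> i = 0" using nonneg_antisym nonneg_simple assms(2) by simp
  then show ?case using simple_nonzero assms(2) by blast
next
  case (Cons j "is")
  then have j: "j \<in> I" and "is": "is \<in> lists I" by auto
  let ?\<beta> = "word is (\<alpha> i)"
  have \<beta>: "?\<beta> \<in> \<Phi>" using "is" assms(2) by (simp add: word_root simple_root)
  show ?case
  proof (cases "nonneg (- ?\<beta>)")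
    case True
    then obtain js where "js \<in> lists I" "length js < length is" "\<forall>v. word is (s i v) = word js v"
      using Cons.IH "is" by blast
    then show ?thesis using j by (intro bexI[of _ "j # js"]) auto
  next
    case False
    then have pos: "nonneg ?\<beta>" using root_signed \<beta> by blast
    \<comment> \<open>The letter \<open>j\<close> turns the positive root \<open>?\<beta>\<close>
      negative, and \<open>\<alpha> j\<close> is the only positive root with this property.\<close>
    have "?\<beta> = \<alpha> j"
    proof (rule ccontr)
      assume "?\<beta> \<noteq> \<alpha> j"
      then have "nonneg (s j ?\<beta>)" using simple_reflection_positive j \<beta> pos by blast
      then have "s j ?\<beta> = 0" using nonneg_antisym Cons.prems by simp
      moreover have "s j ?\<beta> \<in> \<Phi>" using \<beta> j simple_root reflection_root by blast
      ultimately show False using root_nonzero by blast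
    qed
    \<comment> \<open>Conjugation by \<open>word is\<close> carries the reflection in
      \<open>\<alpha> i\<close> to that in \<open>\<alpha> j\<close>, which then cancels against the
      letter \<open>j\<close>.\<close>
    then have "word is (s i v) = s j (word is v)" for v
      using root_reflection_conjugate[OF word_linear word_isometry[OF "is"], where \<beta> = "\<alpha> i" and v = v]
      by simp
    then show ?thesis using "is" j
      by (intro bexI[of _ "is"]) (auto simp: root_reflection_involution simple_nonzero)
  qed
qed

text \<open>Consider the last letter \<open>i\<close>, which acts on \<open>\<nu>\<close> first. If
  the rest \<open>js\<close> of the word keeps \<open>\<alpha> i\<close> positive, dropping
  \<open>i\<close> adds a nonnegative multiple of \<open>word js (\<alpha> i)\<close>; otherwise the
  deletion lemma gives a shorter word with the same action.\<close>

lemma word_dominant_le: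
  assumes "\<nu> \<in> dominant_weights I \<alpha>"
  shows "is \<in> lists I \<Longrightarrow> wle (word is \<nu>) \<nu>"
proof (induction "is" rule: length_induct)
  case (1 "is")
  show ?case
  proof (cases "is" rule: rev_exhaust)
    case Nil
    then show ?thesis by (simp add: wle_refl)
  next
    case (snoc js i)
    then have js: "js \<in> lists I" and i: "i \<in> I" using 1 by auto
    have word: "word is \<nu> = word js (s i \<nu>)" by (simp add: snoc word_append)
    show ?thesis
    proof (cases "nonneg (- word js (\<alpha> i))")
      case True
      then obtain ks where "ks \<in> lists I" "length ks < length js" "word js (s i \<nu>) = word ks \<nu>"
        using word_deletion[OF js i] by blast
      then show ?thesis using 1 word snoc by auto
    next
      case False
      then have "nonneg (word js (\<alpha> i))"
        using root_signed word_root[OF js simple_root[OF i]] by blast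
      then have "nonneg ((\<nu> \<bullet> coroot (\<alpha> i)) *\<^sub>R word js (\<alpha> i))"
        using assms i by (intro nonneg_scale_int) (auto simp: dominant_weights_iff weights_def)
      moreover have "word js \<nu> - word is \<nu> = (\<nu> \<bullet> coroot (\<alpha> i)) *\<^sub>R word js (\<alpha> i)"
        unfolding word by (simp add: root_reflection_def word_simps)
      ultimately have "wle (word is \<nu>) (word js \<nu>)" by (simp add: wle_iff[of "word is \<nu>"])
      moreover have "wle (word js \<nu>) \<nu>" using 1 js snoc by auto
      ultimately show ?thesis by (rule wle_trans)
    qed
  qed
qed

text \<open>A reflection in a simple root on which \<open>\<mu>\<close> is negative lowers the number of positive
  roots on which \<open>\<mu>\<close> is negative.\<close>
lemma dominant_conjugate:
  assumes "\<mu> \<in> weights"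
  shows "\<exists>is\<in>lists I. word is \<mu> \<in> dominant_weights I \<alpha>"
  using assms
proof (induction "card {\<beta> \<in> \<Phi>. nonneg \<beta> \<and> \<mu> \<bullet> \<beta> < 0}" arbitrary: \<mu> rule: less_induct)
  case less
  show ?case
  proof (cases "\<mu> \<in> dominant_weights I \<alpha>")
    case True
    then show ?thesis by (intro bexI[of _ "[]"]) auto
  next
    case False
    then obtain i where i: "i \<in> I" "\<mu> \<bullet> coroot (\<alpha> i) < 0"
      using less.prems unfolding dominant_weights_iff by force
    then have neg: "\<mu> \<bullet> \<alpha> i < 0"
      by (simp add: inner_coroot divide_less_0_iff mult_less_0_iff not_less)
        (smt (verit) inner_ge_zero)
    let ?N = "\<lambda>\<mu>. {\<beta> \<in> \<Phi>. nonneg \<beta> \<and> \<mu> \<bullet> \<beta> < 0}"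
    have fin: "finite (?N \<mu>)" using root_system by (simp add: root_system_def)
    \<comment> \<open>The injection \<open>s i\<close> misses \<open>\<alpha> i\<close>, on which
      \<open>\<mu>\<close> is negative, so the count drops strictly.\<close>
    have "s i ` ?N (s i \<mu>) \<subseteq> ?N \<mu> - {\<alpha> i}"
    proof (rule image_subsetI)
      fix \<beta> assume "\<beta> \<in> ?N (s i \<mu>)"
      then have \<beta>: "\<beta> \<in> \<Phi>" "nonneg \<beta>" "s i \<mu> \<bullet> \<beta> < 0" by auto
      have si: "s i (\<alpha> i) = - \<alpha> i"
        using i by (simp add: root_reflection_def simple_coroot_self scaleR_2)
      have ne: "\<beta> \<noteq> \<alpha> i"
        using \<beta>(3) neg by (auto simp: root_reflection_adjoint si)
      have "s i \<beta> \<noteq> \<alpha> i"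
      proof
        assume "s i \<beta> = \<alpha> i"
        then have "\<beta> = - \<alpha> i" using si root_reflection_involution simple_nonzero i by metis
        then show False
          using nonneg_antisym[OF nonneg_simple[OF i(1)]] \<beta>(2) simple_nonzero i by simp
      qed
      moreover have "s i \<beta> \<in> \<Phi>" using \<beta> i simple_root reflection_root by blast
      moreover have "nonneg (s i \<beta>)" using simple_reflection_positive i \<beta> ne by blast
      ultimately show "s i \<beta> \<in> ?N \<mu> - {\<alpha> i}"
        using \<beta>(3) by (simp add: root_reflection_adjoint)
    qed
    moreover have "inj_on (s i) (?N (s i \<mu>))"
      using i by (intro inj_on_inverseI[of _ "s i"] root_reflection_involution simple_nonzero)
    ultimately have "card (?N (s i \<mu>)) \<le> card (?N \<mu> - {\<alpha> i})"
      using fin by (intro card_inj_on_le) auto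
    also have "\<dots> < card (?N \<mu>)"
      using fin neg i simple_root nonneg_simple by (intro psubset_card_mono) auto
    finally obtain "is" where "is \<in> lists I" "word is (s i \<mu>) \<in> dominant_weights I \<alpha>"
      using less.hyps[of "s i \<mu>"] less.prems i reflection_weight by blast
    then show ?thesis using i by (intro bexI[of _ "is @ [i]"]) (auto simp: word_append)
  qed
qed

text \<open>Expanding one factor of the positive number \<open>\<beta> \<bullet> \<beta>\<close> in
  simple roots yields a positive term. Its coefficient is at least 1, so that simple root can be
  subtracted.\<close>

lemma nonneg_inner_pos:
  assumes "nonneg \<beta>" "\<beta> \<noteq> 0"
  shows "\<exists>i\<in>I. \<beta> \<bullet> coroot (\<alpha> i) > 0 \<and> nonneg (\<beta> - \<alpha> i)"
proof -
  obtain k :: "'i \<Rightarrow> nat" where k: "\<beta> = (\<Sum>i\<in>I. real (k i) *\<^sub>R \<alpha> i)"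
    using assms unfolding nonneg_iff by blast
  have "0 < \<beta> \<bullet> \<beta>" using assms by simp
  also have "\<beta> \<bullet> \<beta> = (\<Sum>i\<in>I. real (k i) * (\<beta> \<bullet> \<alpha> i))"
    by (subst (2) k) (simp add: inner_sum_right)
  finally obtain i where i: "i \<in> I" "real (k i) * (\<beta> \<bullet> \<alpha> i) > 0"
    by (meson not_le sum_nonpos)
  then have "\<beta> \<bullet> \<alpha> i > 0" and ki: "k i \<ge> 1" by (auto simp: zero_less_mult_iff)
  then have "\<beta> \<bullet> coroot (\<alpha> i) > 0" using simple_nonzero i by (simp add: inner_coroot)
  moreover have "\<beta> - \<alpha> i = (\<Sum>j\<in>I. real ((k(i := k i - 1)) j) *\<^sub>R \<alpha> j)"
    unfolding k using i(1) ki finite_I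
    by (simp add: sum.remove[of I i] of_nat_diff scaleR_diff_left)
  ultimately show ?thesis using i(1) unfolding nonneg_iff by blast
qed

text \<open>Induction on the height: a simple reflection lowers a positive root that is not simple
  to another positive root, and the two root reflections are conjugate under it.\<close>

lemma positive_root_reflection_word:
  assumes "\<beta> \<in> \<Phi>" "nonneg \<beta>"
  shows "\<exists>is\<in>lists I. root_reflection \<beta> = word is"
  using assms
proof (induction "nat \<lfloor>\<beta> \<bullet> coweight_sum\<rfloor>" arbitrary: \<beta> rule: less_induct)
  case less
  obtain i where i: "i \<in> I" "\<beta> \<bullet> coroot (\<alpha> i) > 0"
    using nonneg_inner_pos less.prems root_nonzero by blast
  show ?case
  proof (cases "\<beta> = \<alpha> i")
    case True
    moreover have "s i = word [i]" by (rule ext) simp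
    ultimately show ?thesis using i by (intro bexI[of _ "[i]"]) auto
  next
    case False
    let ?\<gamma> = "s i \<beta>"
    have \<gamma>: "?\<gamma> \<in> \<Phi>" "nonneg ?\<gamma>"
      using less.prems i False simple_reflection_positive reflection_root simple_root by auto
    obtain c :: int where c: "\<beta> \<bullet> coroot (\<alpha> i) = of_int c"
      using root_integral[OF simple_root[OF i(1)] less.prems(1)] by (metis Ints_cases)
    then have "?\<gamma> \<bullet> coweight_sum = \<beta> \<bullet> coweight_sum - of_int c"
      by (simp add: root_reflection_def inner_diff_left simple_coweight_sum i)
    \<comment> \<open>The integer \<open>c\<close> is positive and the new height is nonnegative, so
      \<open>nat\<close> does not hide the drop.\<close>
    then have "nat \<lfloor>?\<gamma> \<bullet> coweight_sum\<rfloor> < nat \<lfloor>\<beta> \<bullet> coweight_sum\<rfloor>"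
      using c i nonneg_height[OF \<gamma>(2)] by simp
    then obtain "is" where "is": "is \<in> lists I" "root_reflection ?\<gamma> = word is"
      using less.hyps \<gamma> by blast
    have "root_reflection \<beta> v = word (i # is @ [i]) v" for v
    proof -
      have "word (i # is @ [i]) v = s i (root_reflection ?\<gamma> (s i v))"
        by (simp add: word_append "is")
      also have "root_reflection ?\<gamma> (s i v) = s i (root_reflection \<beta> v)"
        by (intro root_reflection_conjugate root_reflection_linear root_reflection_isometry
            simple_nonzero i)
      finally show ?thesis by (simp add: root_reflection_involution simple_nonzero i)
    qed
    then have "root_reflection \<beta> = word (i # is @ [i])" by (rule ext)
    then show ?thesis using "is" i by (intro bexI[of _ "i # is @ [i]"]) simp_all
  qed
qed

text \<open>This allows induction on word length for Weyl group elements. A negative root has the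
  same reflection as its opposite, so positive roots suffice.\<close>

lemma weyl_word: "w \<in> weyl_group \<Phi> \<Longrightarrow> \<exists>is\<in>lists I. w = word is"
proof (induction rule: weyl_group.induct)
  case id
  have "id = word []" by (rule ext) simp
  then show ?case by blast
next
  case (refl \<beta>)
  have "- \<beta> \<in> \<Phi>" using reflection_root[OF refl refl] root_nonzero[OF refl]
    by (simp add: root_reflection_def inner_coroot scaleR_2)
  then show ?case using root_signed[OF refl] refl positive_root_reflection_word[of \<beta>]
      positive_root_reflection_word[of "- \<beta>"] by (auto simp: root_reflection_minus)
next
  case (comp v w)
  then obtain "is" js where "is \<in> lists I" "v = word is" "js \<in> lists I" "w = word js" by blast
  moreover have "word is \<circ> word js = word (is @ js)" by (rule ext) (simp add: word_append)
  ultimately show ?case by (metis append_in_lists_conv)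
qed

section \<open>Weyl stability and root strings of the sets \<open>\<Pi>(\<kappa>)\<close>\<close>

abbreviation "Pi_verts \<kappa> \<equiv> verts (dominant_Pi \<Phi> I \<alpha> \<kappa>)"

lemma Pi_iff:
  "\<mu> \<in> Pi_verts \<kappa> \<longleftrightarrow> (\<exists>is\<in>lists I. \<exists>\<nu>\<in>dominant_weights I \<alpha>. wle \<nu> \<kappa> \<and> \<mu> = word is \<nu>)"
proof
  assume "\<mu> \<in> Pi_verts \<kappa>"
  then obtain w \<nu> where "w \<in> weyl_group \<Phi>" "\<nu> \<in> dominant_weights I \<alpha>" "wle \<nu> \<kappa>" "\<mu> = w \<nu>"
    by (auto simp: dominant_Pi_def Let_def)
  then show "\<exists>is\<in>lists I. \<exists>\<nu>\<in>dominant_weights I \<alpha>. wle \<nu> \<kappa> \<and> \<mu> = word is \<nu>"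
    using weyl_word[of w] by metis
next
  assume "\<exists>is\<in>lists I. \<exists>\<nu>\<in>dominant_weights I \<alpha>. wle \<nu> \<kappa> \<and> \<mu> = word is \<nu>"
  then obtain "is" \<nu> where "is \<in> lists I" "\<nu> \<in> dominant_weights I \<alpha>" "wle \<nu> \<kappa>" "\<mu> = word is \<nu>"
    by blast
  then have "\<exists>w \<nu>. \<mu> = w \<nu> \<and> w \<in> weyl_group \<Phi> \<and> \<nu> \<in> dominant_weights I \<alpha> \<and> wle \<nu> \<kappa>"
    by (intro exI[of _ "word is"] exI[of _ \<nu>]) (simp add: word_weyl)
  then show "\<mu> \<in> Pi_verts \<kappa>" by (simp add: dominant_Pi_def Let_def)
qed

lemma Pi_edges:
  "edges (dominant_Pi \<Phi> I \<alpha> \<kappa>) =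
     {(\<mu>, i, \<nu>). \<mu> \<in> Pi_verts \<kappa> \<and> \<nu> \<in> Pi_verts \<kappa> \<and> i \<in> I \<and> \<mu> + \<alpha> i = \<nu>}"
  unfolding dominant_Pi_def Let_def by simp

lemma Pi_word: "is \<in> lists I \<Longrightarrow> \<mu> \<in> Pi_verts \<kappa> \<Longrightarrow> word is \<mu> \<in> Pi_verts \<kappa>"
  unfolding Pi_iff by (metis append_in_lists_conv word_append)

lemma PiE:
  assumes "\<mu> \<in> Pi_verts \<kappa>"
  obtains "is" \<nu> where "is \<in> lists I" "\<nu> \<in> dominant_weights I \<alpha>" "wle \<nu> \<kappa>" "\<mu> = word is \<nu>"
  using assms unfolding Pi_iff by (elim bexE conjE) metis

lemma Pi_weight:
  assumes "\<mu> \<in> Pi_verts \<kappa>"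
  shows "\<mu> \<in> weights"
  using assms by (rule PiE) (simp only: dominant_weights_iff word_weight)

lemma Pi_le:
  assumes "\<mu> \<in> Pi_verts \<kappa>"
  shows "wle \<mu> \<kappa>"
  using assms by (rule PiE) (simp only: wle_trans[OF word_dominant_le])

text \<open>The weight \<open>\<mu> - \<alpha> i\<close> lies on the \<open>i\<close>-string between \<open>\<mu>\<close> and \<open>s i \<mu>\<close>, so any conjugate
  of it lies below the corresponding conjugate of one of these two.\<close>
lemma Pi_down:
  assumes \<mu>: "\<mu> \<in> Pi_verts \<kappa>" and i: "i \<in> I" "\<mu> \<bullet> coroot (\<alpha> i) > 0"
  shows "\<mu> - \<alpha> i \<in> Pi_verts \<kappa>"
proof -
  have "\<mu> - \<alpha> i \<in> weights"
    by (rule weights_diff[OF Pi_weight[OF \<mu>] simple_root_weight[OF i(1)]])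
  \<comment> \<open>By stability under words, it suffices to bound a dominant conjugate of
    \<open>\<mu> - \<alpha> i\<close> by \<open>\<kappa>\<close>.\<close>
  then obtain "is" where "is": "is \<in> lists I" "word is (\<mu> - \<alpha> i) \<in> dominant_weights I \<alpha>"
    using dominant_conjugate by blast
  let ?\<eta> = "word is (\<mu> - \<alpha> i)" and ?m = "\<mu> \<bullet> coroot (\<alpha> i)"
  have "wle ?\<eta> \<kappa>"
  proof (cases "nonneg (word is (\<alpha> i))")
    case True
    moreover have "word is \<mu> - ?\<eta> = word is (\<alpha> i)" by (simp add: word_simps)
    ultimately have "wle ?\<eta> (word is \<mu>)" by (simp only: wle_iff[of ?\<eta>])
    moreover have "wle (word is \<mu>) \<kappa>" by (rule Pi_le[OF Pi_word[OF "is"(1) \<mu>]])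
    ultimately show ?thesis by (rule wle_trans)
  next
    case False
    then have "nonneg (- word is (\<alpha> i))"
      using root_signed word_root[OF "is"(1) simple_root[OF i(1)]] by blast
    moreover have m: "?m \<in> \<int>" using Pi_weight[OF \<mu>] i by (simp add: weights_def)
    moreover have "?m \<ge> 1" using m i(2) by (auto elim!: Ints_cases)
    ultimately have "nonneg ((?m - 1) *\<^sub>R (- word is (\<alpha> i)))"
      by (intro nonneg_scale_int) auto
    \<comment> \<open>This is the image of \<open>s i \<mu> = (\<mu> - \<alpha> i) - (?m - 1)
      *\<^sub>R \<alpha> i\<close>; integrality of \<open>?m\<close> makes the factor
      nonnegative.\<close>
    moreover have "word is (s i \<mu>) - ?\<eta> = (?m - 1) *\<^sub>R (- word is (\<alpha> i))"
      by (simp add: root_reflection_def word_simps algebra_simps)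
    ultimately have "wle ?\<eta> (word is (s i \<mu>))" by (simp add: wle_iff[of ?\<eta>])
    moreover have "s i \<mu> \<in> Pi_verts \<kappa>" using Pi_word[of "[i]" \<mu>] i \<mu> by simp
    then have "wle (word is (s i \<mu>)) \<kappa>" by (rule Pi_le[OF Pi_word[OF "is"(1)]])
    ultimately show ?thesis by (rule wle_trans)
  qed
  then have "?\<eta> \<in> Pi_verts \<kappa>" unfolding Pi_iff using "is"(2) by (intro bexI[of _ "[]"]) auto
  then have "word (rev is) ?\<eta> \<in> Pi_verts \<kappa>" by (rule Pi_word[OF word_lists_rev[OF "is"(1)]])
  then show ?thesis by (simp only: word_rev[OF "is"(1)])
qed

text \<open>The reflection \<open>s i\<close> carries the step up from \<open>\<mu>\<close> to the
  step down from \<open>s i \<mu>\<close>.\<close>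

lemma Pi_up:
  assumes \<mu>: "\<mu> \<in> Pi_verts \<kappa>" and i: "i \<in> I" "\<mu> \<bullet> coroot (\<alpha> i) < 0"
  shows "\<mu> + \<alpha> i \<in> Pi_verts \<kappa>"
proof -
  have si: "s i (\<alpha> i) = - \<alpha> i"
    using i by (simp add: root_reflection_def simple_coroot_self scaleR_2)
  have "s i \<mu> \<in> Pi_verts \<kappa>" using Pi_word[of "[i]" \<mu>] i \<mu> by simp
  moreover have "s i \<mu> \<bullet> coroot (\<alpha> i) > 0"
    using i by (simp add: root_reflection_def inner_diff_left simple_coroot_self)
  ultimately have "s i \<mu> - \<alpha> i \<in> Pi_verts \<kappa>" using Pi_down i by blast
  then have "s i (s i \<mu> - \<alpha> i) \<in> Pi_verts \<kappa>" using Pi_word[of "[i]" "s i \<mu> - \<alpha> i"] i by simp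
  then show ?thesis using i by (simp add: root_reflection_simps root_reflection_involution simple_nonzero si)
qed

end

section \<open>Weights of structured posets\<close>

locale structured = root_basis \<Phi> I \<alpha>
  for \<Phi> :: "'a::euclidean_space set" and I :: "'i set" and \<alpha> :: "'i \<Rightarrow> 'a" +
  fixes R :: "'r set" and le :: "'r rel" and col :: "'r \<Rightarrow> 'r \<Rightarrow> 'i"
  assumes structured: "structured_poset I \<alpha> R le col"
begin

abbreviation "G \<equiv> hasse R le col"
abbreviation "weight \<equiv> wt I \<alpha> G"

lemma finite_R: "finite R" and nonempty_R: "R \<noteq> {}"
  using structured by (auto simp: structured_poset_def colored_ranked_poset_def)

lemma verts_G: "verts G = R"
  by (simp add: hasse_def)

lemma edge_props:
  assumes "(x, i, y) \<in> edges G"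
  shows "x \<in> R" "y \<in> R" "i \<in> I" "weight x + \<alpha> i = weight y"
  using assms structured
  by (auto simp: hasse_def covers_def structured_poset_def colored_ranked_poset_def)

lemma comp_subset:
  assumes "x \<in> R"
  shows "color_comp G i x \<subseteq> R"
proof
  fix y assume "y \<in> color_comp G i x"
  then show "y \<in> R"
    using assms by (induction rule: color_comp_induct) (blast dest: edge_props(1,2))+
qed

lemma comp_rank_function:
  assumes "x \<in> R"
  shows "\<exists>r l. is_rank_function (color_comp G i x) (comp_edges G i x) r l"
proof -
  obtain \<rho> l where "is_rank_function R {(s, t). covers R le s t} \<rho> l"
    using structured unfolding structured_poset_def colored_ranked_poset_def by blast
  then have "\<rho> s + 1 = \<rho> t" if "(s, i, t) \<in> edges G" for s t
    using that unfolding hasse_def is_rank_function_def by auto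
  then show ?thesis
    by (intro comp_rank_function_exists finite_subset[OF comp_subset[OF assms] finite_R])
qed

text \<open>Every edge of color \<open>i\<close> adds \<open>\<alpha> i\<close>, so along the
  component the weight is an affine function of the rank.\<close>

lemma weight_comp:
  assumes r: "is_rank_function (color_comp G i x) (comp_edges G i x) r l"
    and "y \<in> color_comp G i x"
  shows "weight y = weight x + (real (r y) - real (r x)) *\<^sub>R \<alpha> i"
  using assms(2)
proof (induction rule: color_comp_induct)
  case base
  then show ?case by simp
next
  case (up y z)
  then have "real (r z) = real (r y) + 1" using r unfolding is_rank_function_comp
    by (metis of_nat_1 of_nat_add)
  moreover have "weight z = weight y + \<alpha> i" using edge_props(4)[OF up(3)] by simp
  ultimately show ?case using up(4) by (simp add: algebra_simps)
next
  case (down y z)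
  then have "real (r z) = real (r y) + 1" using r unfolding is_rank_function_comp
    by (metis of_nat_1 of_nat_add)
  moreover have "weight y = weight z - \<alpha> i" using edge_props(4)[OF down(3)] by (simp add: eq_diff_eq)
  ultimately show ?case using down(4) by (simp add: algebra_simps)
qed

lemma color_rank_bounds:
  assumes "x \<in> R"
  shows "0 \<le> color_rank G i x" "color_rank G i x \<le> color_length G i x"
proof -
  obtain r l where r: "is_rank_function (color_comp G i x) (comp_edges G i x) r l"
    using comp_rank_function assms by blast
  moreover have "r x \<le> l" using r color_comp_refl[of x G i] unfolding is_rank_function_comp by auto
  ultimately show "0 \<le> color_rank G i x" "color_rank G i x \<le> color_length G i x"
    using color_rank_eq[OF r color_comp_refl] by auto
qed

lemma comp_vertex:
  assumes "x \<in> R" "0 \<le> k" "k \<le> color_length G i x"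
  shows "\<exists>y\<in>R. weight y = weight x + of_int (k - color_rank G i x) *\<^sub>R \<alpha> i"
proof -
  obtain r l where r: "is_rank_function (color_comp G i x) (comp_edges G i x) r l"
    using comp_rank_function assms by blast
  note eq = color_rank_eq[OF r color_comp_refl]
  have "nat k \<in> r ` color_comp G i x" using r assms eq unfolding is_rank_function_comp by auto
  then obtain y where "y \<in> color_comp G i x" "int (r y) = k" using assms by force
  then show ?thesis using weight_comp[OF r, of y] comp_subset[OF assms(1), of i] eq
    by (intro bexI[of _ y]) auto
qed

text \<open>The edge enters rank \<open>k\<close> but may lie elsewhere in the component of
  \<open>x\<close>. Controlling the weight of its end is enough, because the edges of
  \<open>poset_Pi\<close> record only weights.\<close>

lemma comp_edge:
  assumes "x \<in> R" "1 \<le> k" "k \<le> color_length G i x"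
  shows "\<exists>y z. (y, i, z) \<in> edges G \<and> weight z = weight x + of_int (k - color_rank G i x) *\<^sub>R \<alpha> i"
proof -
  obtain r l where r: "is_rank_function (color_comp G i x) (comp_edges G i x) r l"
    using comp_rank_function assms by blast
  note eq = color_rank_eq[OF r color_comp_refl]
  have "0 \<in> r ` color_comp G i x" "l \<in> r ` color_comp G i x"
    using r unfolding is_rank_function_comp by auto
  then obtain a b where "a \<in> color_comp G i x" "r a < nat k" "b \<in> color_comp G i x" "nat k \<le> r b"
    using assms eq by force
  with color_comp_crossing[of i G x r a b "nat k"] r obtain y z
    where yz: "(y, i, z) \<in> edges G" "z \<in> color_comp G i x" "r z = nat k"
    unfolding is_rank_function_comp by blast
  then have "weight z = weight x + of_int (k - color_rank G i x) *\<^sub>R \<alpha> i"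
    using weight_comp[OF r yz(2)] eq assms by simp
  then show ?thesis using yz by blast
qed

lemma weight_coroot:
  assumes "i \<in> I"
  shows "weight x \<bullet> coroot (\<alpha> i) = of_int (2 * color_rank G i x - color_length G i x)"
  unfolding wt_def inner_sum_fundamental[OF assms] by (simp add: color_depth_def)

lemma weight_weights: "weight x \<in> weights"
  unfolding weights_def by (auto simp: weight_coroot) (simp add: wt_def sum_fundamental_span)

lemma down_edge:
  assumes "x \<in> R" "i \<in> I" "weight x \<bullet> coroot (\<alpha> i) > 0"
  shows "\<exists>y z. (y, i, z) \<in> edges G \<and> weight z = weight x"
proof -
  have "color_rank G i x \<ge> 1"
    using assms color_rank_bounds[OF assms(1), of i] by (simp add: weight_coroot)
  then show ?thesis using comp_edge[of x "color_rank G i x" i] color_rank_bounds assms by simp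
qed

lemma up_edge:
  assumes "x \<in> R" "i \<in> I" "weight x \<bullet> coroot (\<alpha> i) < 0"
  shows "\<exists>y z. (y, i, z) \<in> edges G \<and> weight y = weight x"
proof -
  have "color_rank G i x + 1 \<le> color_length G i x"
    using assms color_rank_bounds[OF assms(1), of i] by (simp add: weight_coroot)
  \<comment> \<open>An edge into the rank above that of \<open>x\<close> starts at the weight of
    \<open>x\<close>.\<close>
  then obtain y z where "(y, i, z) \<in> edges G" "weight z = weight x + \<alpha> i"
    using comp_edge[of x "color_rank G i x + 1" i] color_rank_bounds assms by auto
  then show ?thesis using edge_props(4) by (metis add_right_cancel)
qed

lemma weights_word:
  assumes "is \<in> lists I" "\<mu> \<in> weight ` R"
  shows "word is \<mu> \<in> weight ` R"
  using assms
proof (induction "is")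
  case (Cons i "is")
  then obtain x where x: "x \<in> R" "word is \<mu> = weight x" and i: "i \<in> I" by auto
  \<comment> \<open>An element at the mirrored rank, length minus rank; its weight differs from that
    of \<open>x\<close> by minus the pairing times \<open>\<alpha> i\<close>.\<close>
  obtain y where y: "y \<in> R"
    "weight y = weight x
       + of_int (color_length G i x - color_rank G i x - color_rank G i x) *\<^sub>R \<alpha> i"
    using comp_vertex[of x "color_length G i x - color_rank G i x" i] x color_rank_bounds[OF x(1), of i]
    by force
  then have "word (i # is) \<mu> = weight y"
    using x i by (simp add: root_reflection_def weight_coroot algebra_simps)
  then show ?case using y by blast
qed simp

text \<open>Some simple root occurring in \<open>\<mu> - \<nu>\<close> pairs positively with \<open>\<mu> - \<nu>\<close>, and therefore with \<open>\<mu>\<close>,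
  because \<open>\<nu>\<close> is dominant; it can be subtracted from \<open>\<mu>\<close> along an edge of \<open>R\<close>.\<close>
lemma weights_saturated:
  assumes "\<mu> \<in> weight ` R" "\<nu> \<in> dominant_weights I \<alpha>" "wle \<nu> \<mu>"
  shows "\<nu> \<in> weight ` R"
  using assms(1,3)
proof (induction "nat \<lfloor>(\<mu> - \<nu>) \<bullet> coweight_sum\<rfloor>" arbitrary: \<mu> rule: less_induct)
  case less
  show ?case
  proof (cases "\<mu> = \<nu>")
    case True
    then show ?thesis using less by simp
  next
    case False
    then obtain i where i: "i \<in> I" "(\<mu> - \<nu>) \<bullet> coroot (\<alpha> i) > 0" "nonneg (\<mu> - \<nu> - \<alpha> i)"
      using nonneg_inner_pos[of "\<mu> - \<nu>"] less.prems wle_iff[of \<nu>] by auto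
    obtain x where x: "x \<in> R" "\<mu> = weight x" using less.prems by auto
    have "\<nu> \<bullet> coroot (\<alpha> i) \<ge> 0" using assms(2) i by (simp add: dominant_weights_iff)
    then have "weight x \<bullet> coroot (\<alpha> i) > 0" using i x by (simp add: inner_diff_left)
    then obtain y z where yz: "(y, i, z) \<in> edges G" "weight z = \<mu>" using down_edge x i by metis
    then have y: "weight y = \<mu> - \<alpha> i" "y \<in> R" using edge_props by (auto simp: algebra_simps)
    have le: "wle \<nu> (\<mu> - \<alpha> i)" using i(3) by (simp add: wle_iff[of \<nu>] algebra_simps)
    moreover have "(\<mu> - \<alpha> i - \<nu>) \<bullet> coweight_sum = (\<mu> - \<nu>) \<bullet> coweight_sum - 1"
      by (simp add: inner_diff_left simple_coweight_sum i)
    then have "nat \<lfloor>(\<mu> - \<alpha> i - \<nu>) \<bullet> coweight_sum\<rfloor> < nat \<lfloor>(\<mu> - \<nu>) \<bullet> coweight_sum\<rfloor>"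
      using wle_height[OF le] by (simp add: inner_diff_left) linarith
    ultimately show ?thesis using less.hyps[of "\<mu> - \<alpha> i"] y by (metis imageI)
  qed
qed

section \<open>Maximal weights and prominent elements\<close>

lemma not_prominent_raise:
  assumes "x \<in> R" "\<not> prominent I G x"
  shows "\<exists>y\<in>R. wle (weight x) (weight y) \<and> weight y \<noteq> weight x"
proof -
  obtain i where i: "i \<in> I" "color_depth G i x \<noteq> 0"
    using assms unfolding prominent_def verts_G by blast
  \<comment> \<open>An element at the top rank of the component; the depth of \<open>x\<close> is
    positive, so the weight strictly increases.\<close>
  obtain y where y: "y \<in> R" "weight y = weight x + of_int (color_depth G i x) *\<^sub>R \<alpha> i"
    using comp_vertex[OF assms(1), of "color_length G i x" i] color_rank_bounds[OF assms(1), of i]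
    unfolding color_depth_def by auto
  have "nonneg (of_int (color_depth G i x) *\<^sub>R \<alpha> i)"
    using color_rank_bounds[OF assms(1), of i] nonneg_simple i
    by (intro nonneg_scale_int) (auto simp: color_depth_def)
  then have "wle (weight x) (weight y)" by (simp add: wle_iff[of "weight x"] y)
  moreover have "weight y \<noteq> weight x" using y i simple_nonzero by simp
  ultimately show ?thesis using y by blast
qed

text \<open>Maximality refers to the weight, not to the order of \<open>R\<close>; several elements
  may share a maximal weight.\<close>

definition maximal :: "'r \<Rightarrow> bool"
  where "maximal x \<longleftrightarrow> x \<in> R \<and> (\<forall>y\<in>R. wle (weight x) (weight y) \<longrightarrow> weight y = weight x)"

lemma maximal_prominent: "maximal x \<Longrightarrow> prominent I G x"
  unfolding maximal_def using not_prominent_raise by blast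

text \<open>Among the finitely many elements with weight above that of \<open>x\<close>, one of
  greatest height is maximal, since comparable weights of equal height coincide.\<close>

lemma maximal_above:
  assumes "x \<in> R"
  shows "\<exists>y. maximal y \<and> wle (weight x) (weight y)"
proof -
  let ?A = "{y \<in> R. wle (weight x) (weight y)}" and ?h = "\<lambda>y. weight y \<bullet> coweight_sum"
  have "finite ?A" "?A \<noteq> {}" using finite_R assms wle_refl by auto
  then have "Max (?h ` ?A) \<in> ?h ` ?A" by (intro Max_in) auto
  then obtain y where y: "y \<in> ?A" "Max (?h ` ?A) = ?h y" by auto
  then have max: "?h z \<le> ?h y" if "z \<in> ?A" for z
    unfolding y(2)[symmetric] by (intro Max_ge finite_imageI imageI \<open>finite ?A\<close> that)
  have "weight z = weight y" if "z \<in> R" "wle (weight y) (weight z)" for z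
  proof -
    have "wle (weight x) (weight z)" using y(1) that(2) wle_trans by blast
    then have "?h z \<le> ?h y" using max that(1) by simp
    then show ?thesis using wle_height_eq[OF that(2)] by simp
  qed
  then show ?thesis using y(1) unfolding maximal_def by blast
qed

section \<open>The equivalence of the three conditions\<close>

definition Pi_union :: "'r set \<Rightarrow> 'a set"
  where "Pi_union N = (\<Union>n\<in>N. Pi_verts (weight n))"

text \<open>Both sides are stable under words, so dominant weights decide. A dominant weight of
  \<open>R\<close> lies below a maximal, hence prominent, element and so below some \<open>d\<close>
  in \<open>D\<close>; saturation gives the other inclusion.\<close>

lemma weights_eq_if_indomitable:
  assumes "N \<subseteq> R" "indomitable I \<alpha> G D" "D \<subseteq> N"
  shows "weight ` R = Pi_union N"
proof (intro equalityI subsetI)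
  fix \<mu> assume \<mu>: "\<mu> \<in> weight ` R"
  then obtain "is" where "is": "is \<in> lists I" "word is \<mu> \<in> dominant_weights I \<alpha>"
    using dominant_conjugate weight_weights by blast
  obtain x where "x \<in> R" "word is \<mu> = weight x" using weights_word[OF "is"(1) \<mu>] by blast
  then obtain y where "maximal y" "wle (word is \<mu>) (weight y)" using maximal_above by metis
  then obtain d where d: "d \<in> D" "wle (word is \<mu>) (weight d)"
    using maximal_prominent assms(2) wle_trans unfolding indomitable_def by metis
  have "word is \<mu> \<in> Pi_verts (weight d)" unfolding Pi_iff
    using d "is"(2) by (intro bexI[of _ "[]"]) auto
  then have "word (rev is) (word is \<mu>) \<in> Pi_verts (weight d)"
    by (rule Pi_word[OF word_lists_rev[OF "is"(1)]])
  then show "\<mu> \<in> Pi_union N"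
    unfolding word_rev[OF "is"(1)] using d(1) assms(3) unfolding Pi_union_def by blast
next
  fix \<mu> assume "\<mu> \<in> Pi_union N"
  then obtain n where n: "n \<in> N" "\<mu> \<in> Pi_verts (weight n)" unfolding Pi_union_def by blast
  from n(2) obtain "is" \<nu> where \<nu>: "is \<in> lists I" "\<nu> \<in> dominant_weights I \<alpha>"
    "wle \<nu> (weight n)" "\<mu> = word is \<nu>"
    by (rule PiE)
  have "weight n \<in> weight ` R" using n(1) assms(1) by blast
  then have "\<nu> \<in> weight ` R" using \<nu>(2,3) by (rule weights_saturated)
  then show "\<mu> \<in> weight ` R" unfolding \<nu>(4) by (rule weights_word[OF \<nu>(1)])
qed

text \<open>A maximal weight lies in some \<open>\<Pi>(wt(n))\<close>, hence below
  \<open>weight n\<close>, hence equals it. The set \<open>D\<close> takes one such \<open>n\<close>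
  for each maximal weight.\<close>

lemma indomitable_if_weights_eq:
  assumes "N \<subseteq> R" and eq: "weight ` R = Pi_union N"
  shows "\<exists>D. minimally_indomitable I \<alpha> G D \<and> D \<subseteq> N"
proof -
  have "\<exists>n\<in>N. weight n = weight x" if x: "maximal x" for x
  proof -
    have "weight x \<in> Pi_union N" using x eq unfolding maximal_def by blast
    then obtain n where "n \<in> N" "wle (weight x) (weight n)"
      unfolding Pi_union_def using Pi_le by blast
    then show ?thesis using x assms(1) unfolding maximal_def by blast
  qed
  \<comment> \<open>The choice depends on the weight alone, so distinct elements of \<open>D\<close>
    have distinct weights.\<close>
  then obtain f where f: "\<And>\<mu>. \<mu> \<in> weight ` {x. maximal x} \<Longrightarrow> f \<mu> \<in> N \<and> weight (f \<mu>) = \<mu>"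
  proof -
    have "\<forall>\<mu>\<in>weight ` {x. maximal x}. \<exists>n. n \<in> N \<and> weight n = \<mu>"
      using \<open>\<And>x. maximal x \<Longrightarrow> \<exists>n\<in>N. weight n = weight x\<close> by blast
    from bchoice[OF this] show ?thesis using that by blast
  qed
  define D where "D = f ` weight ` {x. maximal x}"
  have DN: "D \<subseteq> N" unfolding D_def using f by blast
  have D_maximal: "maximal d" if d: "d \<in> D" for d
  proof -
    obtain x where x: "maximal x" "d = f (weight x)" using d unfolding D_def by blast
    then have "d \<in> R" "weight d = weight x" using f assms(1) by auto
    then show ?thesis using x(1) unfolding maximal_def by simp
  qed
  have "f (weight d) = d" if "d \<in> D" for d
    using that f unfolding D_def by auto
  then have D_inj: "d = d'" if "d \<in> D" "d' \<in> D" "weight d = weight d'" for d d'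
    using that by metis
  have above: "\<exists>d\<in>D. wle (weight x) (weight d)" if x: "x \<in> R" for x
  proof -
    obtain y where "maximal y" "wle (weight x) (weight y)" using maximal_above x by blast
    then show ?thesis using f[of "weight y"] unfolding D_def
      by (intro bexI[of _ "f (weight y)"]) auto
  qed
  have "indomitable I \<alpha> G D" unfolding indomitable_def
    using above D_maximal maximal_prominent nonempty_R by (auto simp: prominent_def verts_G)
  \<comment> \<open>A removed \<open>d\<close> would have to lie below a remaining
    \<open>d'\<close>, which by maximality has the same weight and thus equals
    \<open>d\<close>.\<close>
  moreover have "\<not> indomitable I \<alpha> G D'" if sub: "D' \<subset> D" for D'
  proof
    assume ind: "indomitable I \<alpha> G D'"
    obtain d where d: "d \<in> D" "d \<notin> D'" using sub by blast
    then obtain d' where d': "d' \<in> D'" "wle (weight d) (weight d')"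
      using ind D_maximal maximal_prominent unfolding indomitable_def by metis
    then have "weight d' = weight d" using D_maximal[OF d(1)] sub DN assms(1) unfolding maximal_def by blast
    then show False using D_inj d d' sub by blast
  qed
  ultimately show ?thesis unfolding minimally_indomitable_def using DN by blast
qed

text \<open>The pairings of the two ends of an edge of color \<open>i\<close> with the coroot of
  \<open>\<alpha> i\<close> differ by 2, so the upper end pairs positively or the lower one
  negatively. In either case that end determines the edge, both in \<open>R\<close> and in any
  \<open>\<Pi>(wt(n))\<close> containing it.\<close>

lemma edges_eq_if_weights_eq:
  assumes eq: "weight ` R = Pi_union N"
  shows "edges (poset_Pi I \<alpha> G) = (\<Union>n\<in>N. edges (dominant_Pi \<Phi> I \<alpha> (weight n)))"
proof (intro equalityI subsetI)
  fix e assume "e \<in> edges (poset_Pi I \<alpha> G)"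
  then obtain x i y where e: "e = (weight x, i, weight y)" "(x, i, y) \<in> edges G"
    by (auto simp: poset_Pi_def)
  note props = edge_props[OF e(2)]
  \<comment> \<open>Equality of vertex sets could place the two ends in \<open>\<Pi>(wt(n))\<close>
    for different \<open>n\<close>; an edge of the union needs a common one.\<close>
  have "\<exists>n\<in>N. weight x \<in> Pi_verts (weight n) \<and> weight y \<in> Pi_verts (weight n)"
  proof (cases "weight y \<bullet> coroot (\<alpha> i) > 0")
    case True
    obtain n where n: "n \<in> N" "weight y \<in> Pi_verts (weight n)"
      using props eq unfolding Pi_union_def by blast
    have "weight y - \<alpha> i = weight x" using props(4) by (metis add_diff_cancel_right')
    then have "weight x \<in> Pi_verts (weight n)" using Pi_down[OF n(2) props(3) True] by simp
    then show ?thesis using n by blast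
  next
    case False
    obtain n where n: "n \<in> N" "weight x \<in> Pi_verts (weight n)"
      using props eq unfolding Pi_union_def by blast
    have "weight y \<bullet> coroot (\<alpha> i) = weight x \<bullet> coroot (\<alpha> i) + 2"
      using simple_coroot_self[OF props(3)] props(4) by (metis inner_add_left)
    then have "weight x \<bullet> coroot (\<alpha> i) < 0" using False by linarith
    then have "weight y \<in> Pi_verts (weight n)" using Pi_up[OF n(2) props(3)] props(4) by simp
    then show ?thesis using n by blast
  qed
  then show "e \<in> (\<Union>n\<in>N. edges (dominant_Pi \<Phi> I \<alpha> (weight n)))"
    using props e unfolding Pi_edges by auto
next
  fix e assume "e \<in> (\<Union>n\<in>N. edges (dominant_Pi \<Phi> I \<alpha> (weight n)))"
  then obtain n \<mu> i \<nu> where e: "e = (\<mu>, i, \<nu>)" "n \<in> N" "\<mu> \<in> Pi_verts (weight n)" "\<nu> \<in> Pi_verts (weight n)"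
    "i \<in> I" "\<mu> + \<alpha> i = \<nu>"
    unfolding Pi_edges by auto
  then obtain x y where xy: "x \<in> R" "y \<in> R" "\<mu> = weight x" "\<nu> = weight y"
    using eq unfolding Pi_union_def by (metis (no_types, lifting) UN_I imageE)
  \<comment> \<open>Elements with the weights \<open>\<mu>\<close> and \<open>\<nu>\<close> need not
    be adjacent; the sign of the pairing provides an actual edge.\<close>
  have "\<exists>u v. (u, i, v) \<in> edges G \<and> weight u = \<mu> \<and> weight v = \<nu>"
  proof (cases "\<nu> \<bullet> coroot (\<alpha> i) > 0")
    case True
    then obtain u v where uv: "(u, i, v) \<in> edges G" "weight v = \<nu>"
      using down_edge xy e by metis
    then show ?thesis using edge_props(4)[OF uv(1)] e(6) by (metis add_right_cancel)
  next
    case False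
    have "\<nu> \<bullet> coroot (\<alpha> i) = \<mu> \<bullet> coroot (\<alpha> i) + 2"
      using simple_coroot_self[OF e(5)] e(6) by (metis inner_add_left)
    then have "\<mu> \<bullet> coroot (\<alpha> i) < 0" using False by linarith
    then obtain u v where uv: "(u, i, v) \<in> edges G" "weight u = \<mu>"
      using up_edge xy e by metis
    then show ?thesis using edge_props(4)[OF uv(1)] e(6) by metis
  qed
  then show "e \<in> edges (poset_Pi I \<alpha> G)" unfolding poset_Pi_def e(1) by auto
qed

end

theorem theorem3p8:
  fixes \<Phi> :: "'a::euclidean_space set" and I :: "'i set" and \<alpha> :: "'i \<Rightarrow> 'a"
    and R :: "'r set" and le :: "'r rel" and col :: "'r \<Rightarrow> 'r \<Rightarrow> 'i" and N :: "'r set"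
  assumes "root_system \<Phi>" and "simple_roots \<Phi> I \<alpha>"
    and "structured_poset I \<alpha> R le col"
    and "N \<subseteq> R"
    and "\<And>n. n \<in> N \<Longrightarrow> wt I \<alpha> (hasse R le col) n \<in> dominant_weights I \<alpha>"
  shows
    "(poset_Pi I \<alpha> (hasse R le col)
        = digraph_Union ((\<lambda>n. dominant_Pi \<Phi> I \<alpha> (wt I \<alpha> (hasse R le col) n)) ` N)
      \<longleftrightarrow> verts (poset_Pi I \<alpha> (hasse R le col))
        = (\<Union>n\<in>N. verts (dominant_Pi \<Phi> I \<alpha> (wt I \<alpha> (hasse R le col) n))))
     \<and> (verts (poset_Pi I \<alpha> (hasse R le col))
        = (\<Union>n\<in>N. verts (dominant_Pi \<Phi> I \<alpha> (wt I \<alpha> (hasse R le col) n)))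
      \<longleftrightarrow> (\<exists>D. minimally_indomitable I \<alpha> (hasse R le col) D \<and> D \<subseteq> N))"
proof -
  interpret structured \<Phi> I \<alpha> R le col
    by unfold_locales fact+
  have verts: "verts (poset_Pi I \<alpha> G) = (\<Union>n\<in>N. Pi_verts (weight n)) \<longleftrightarrow> weight ` R = Pi_union N"
    by (simp add: poset_Pi_def verts_G Pi_union_def)
  have "poset_Pi I \<alpha> G = digraph_Union ((\<lambda>n. dominant_Pi \<Phi> I \<alpha> (weight n)) ` N)"
    if "verts (poset_Pi I \<alpha> G) = (\<Union>n\<in>N. Pi_verts (weight n))"
    using that edges_eq_if_weights_eq[of N] unfolding verts digraph_Union_def
    by (simp add: verts[THEN iffD2])
  moreover have "verts (poset_Pi I \<alpha> G) = (\<Union>n\<in>N. Pi_verts (weight n))"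
    if "poset_Pi I \<alpha> G = digraph_Union ((\<lambda>n. dominant_Pi \<Phi> I \<alpha> (weight n)) ` N)"
    using that by (simp add: digraph_Union_def)
  moreover have "weight ` R = Pi_union N \<longleftrightarrow> (\<exists>D. minimally_indomitable I \<alpha> G D \<and> D \<subseteq> N)"
  proof
    show "weight ` R = Pi_union N" if "\<exists>D. minimally_indomitable I \<alpha> G D \<and> D \<subseteq> N"
      using that weights_eq_if_indomitable[OF \<open>N \<subseteq> R\<close>] by (auto simp: minimally_indomitable_def)
  qed (rule indomitable_if_weights_eq[OF \<open>N \<subseteq> R\<close>])
  ultimately show ?thesis unfolding verts by blast
qed

end
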